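(* Let $n\ge3$ and $I=\{1,\dots,n-1\}$ label the path diagram $A_{n-1}$. Then $\mathrm{Spin}(n)$, together with the homomorphisms $\tau_{i,i+1}:=\widetilde\varepsilon_{\{i,i+1,i+2\}}:\mathrm{Spin}(3)\to\mathrm{Spin}(n)$ and, for $i<j$ with $j\ne i+1$, $\tau_{ij}:\mathrm{Spin}(2)\times\mathrm{Spin}(2)\to\mathrm{Spin}(n)$, $(x,y)\mapsto \widetilde\varepsilon_{\{i,i+1\}}(x)\,\widetilde\varepsilon_{\{j,j+1\}}(y)$, is a universal enveloping group of the standard $\mathrm{Spin}(2)$-amalgam $\mathcal A(A_{n-1},\mathrm{Spin}(2))$.
   Context: $\mathrm{Spin}(m)$ is realised in the real Clifford algebra generated by $e_1,\dots,e_m$ with $e_k^2=-1$, $e_ke_l=-e_le_k$ ($k\ne l$); $\mathrm{Spin}(2)=\{S(\alpha)=\cos\alpha+\sin\alpha\,e_1e_2\}$. For $L=\{l_1<\dots<l_m\}\subseteq\{1,\dots,n\}$, $\widetilde\varepsilon_L:\mathrm{Spin}(m)\to\mathrm{Spin}(n)$ is the embedding induced by $e_k\mapsto e_{l_k}$. The standard $\mathrm{Spin}(2)$-amalgam $\mathcal A(A_{n-1},\mathrm{Spin}(2))$ has $G_{i,i+1}=\mathrm{Spin}(3)$ with $\phi^i_{i,i+1}=\widetilde\varepsilon_{\{1,2\}}$ ($a+be_1e_2\mapsto a+be_1e_2$), $\phi^{i+1}_{i,i+1}=\widetilde\varepsilon_{\{2,3\}}$ ($a+be_1e_2\mapsto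 a+be_2e_3$), and for $i<j$, $j\ne i+1$, $G_{ij}=\mathrm{Spin}(2)\times\mathrm{Spin}(2)$ with $\phi^i_{ij}(x)=(x,1)$, $\phi^j_{ij}(x)=(1,x)$. Enveloping and universal enveloping groups of an amalgam $\{G_{ij},\phi^i_{ij}\}$: a group $G$ with homomorphisms $\tau_{ij}:G_{ij}\to G$ whose images generate $G$, satisfying $\tau_{ij}\circ\phi^j_{ij}=\tau_{kj}\circ\phi^j_{kj}$ for pairwise distinct $i,j,k$; universal if it maps uniquely and compatibly onto every other enveloping group. *)

theory Defs
  imports "HOL-Algebra.Algebra"
begin

text \<open>Multivectors of the real Clifford algebra generated by e_1, e_2, ... with
  e_k^2 = -1 and anticommuting generators: a multivector is the coefficient
  function on basis blades e_S (S a finite set of positive indices, product taken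
  in increasing order).\<close>

type_synonym mvec = "nat set \<Rightarrow> real"

text \<open>Sign in e_S e_S' = sign * e_(S symdiff S').\<close>
definition blade_sign :: "nat set \<Rightarrow> nat set \<Rightarrow> real" where
  "blade_sign S S' =
     (-1) ^ (card {(s, t). s \<in> S \<and> t \<in> S' \<and> t < s} + card (S \<inter> S'))"

definition cl_mult :: "nat \<Rightarrow> mvec \<Rightarrow> mvec \<Rightarrow> mvec" where
  "cl_mult n a b = (\<lambda>T. \<Sum>S\<in>Pow {1..n}. \<Sum>S'\<in>Pow {1..n}.
      if (S - S') \<union> (S' - S) = T then blade_sign S S' * a S * b S' else 0)"

definition cl_one :: mvec where
  "cl_one = (\<lambda>T. if T = {} then 1 else 0)"

definition cl_vec :: "nat \<Rightarrow> (nat \<Rightarrow> real) \<Rightarrow> mvec" where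
  "cl_vec m c = (\<lambda>T. if \<exists>k\<in>{1..m}. T = {k} then c (the_elem T) else 0)"

definition Spin :: "nat \<Rightarrow> mvec set" where
  "Spin m = {x. \<exists>vs :: (nat \<Rightarrow> real) list. even (length vs) \<and>
      (\<forall>c\<in>set vs. (\<Sum>k=1..m. (c k)\<^sup>2) = 1) \<and>
      x = foldr (cl_mult m) (map (cl_vec m) vs) cl_one}"

definition spin_grp :: "nat \<Rightarrow> mvec monoid" where
  "spin_grp m = \<lparr>carrier = Spin m, monoid.mult = cl_mult m, one = cl_one\<rparr>"

text \<open>The embedding induced by e_k \<mapsto> e_(l_k), where l_1 < ... < l_m enumerate L
  (m = card L).\<close>
definition emb :: "nat set \<Rightarrow> mvec \<Rightarrow> mvec" where
  "emb L x = (\<lambda>T. \<Sum>S\<in>Pow {1..card L}.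
      if (\<lambda>k. sorted_list_of_set L ! (k - 1)) ` S = T then x S else 0)"

definition spin22 :: "(mvec \<times> mvec) monoid" where
  "spin22 = spin_grp 2 \<times>\<times> spin_grp 2"

text \<open>Given an enveloping family (tA i on G_(i,i+1), tB i j on G_ij with i<j,
  j \<noteq> i+1), the composite tau_(ij) \<circ> phi^j_(ij) : Spin(2) \<rightarrow> H, for
  distinct vertices i, j (pair unordered).\<close>
definition vmap :: "(nat \<Rightarrow> mvec \<Rightarrow> 'g) \<Rightarrow> (nat \<Rightarrow> nat \<Rightarrow> mvec \<times> mvec \<Rightarrow> 'g)
    \<Rightarrow> nat \<Rightarrow> nat \<Rightarrow> mvec \<Rightarrow> 'g" where
  "vmap tA tB i j x =
     (if j = i + 1 then tA i (emb {2, 3} x)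
      else if i = j + 1 then tA j (emb {1, 2} x)
      else if i < j then tB i j (cl_one, x)
      else tB j i (x, cl_one))"

definition envelope :: "nat \<Rightarrow> ('g, 'z) monoid_scheme \<Rightarrow> (nat \<Rightarrow> mvec \<Rightarrow> 'g)
    \<Rightarrow> (nat \<Rightarrow> nat \<Rightarrow> mvec \<times> mvec \<Rightarrow> 'g) \<Rightarrow> bool" where
  "envelope n H tA tB \<longleftrightarrow>
     group H \<and>
     (\<forall>i. 1 \<le> i \<and> i + 1 \<le> n - 1 \<longrightarrow> tA i \<in> hom (spin_grp 3) H) \<and>
     (\<forall>i j. 1 \<le> i \<and> i + 1 < j \<and> j \<le> n - 1 \<longrightarrow> tB i j \<in> hom spin22 H) \<and>
     carrier H = generate H
        ((\<Union>i\<in>{i. 1 \<le> i \<and> i + 1 \<le> n - 1}. tA i ` Spin 3) \<union>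
         (\<Union>(i, j)\<in>{(i, j). 1 \<le> i \<and> i + 1 < j \<and> j \<le> n - 1}. tB i j ` carrier spin22)) \<and>
     (\<forall>i j k. i \<in> {1..n-1} \<and> j \<in> {1..n-1} \<and> k \<in> {1..n-1} \<and>
        i \<noteq> j \<and> j \<noteq> k \<and> i \<noteq> k \<longrightarrow>
        (\<forall>x\<in>Spin 2. vmap tA tB i j x = vmap tA tB k j x))"

definition tauA :: "nat \<Rightarrow> mvec \<Rightarrow> mvec" where
  "tauA i = emb {i, i + 1, i + 2}"

definition tauB :: "nat \<Rightarrow> nat \<Rightarrow> nat \<Rightarrow> mvec \<times> mvec \<Rightarrow> mvec" where
  "tauB n i j p = cl_mult n (emb {i, i + 1} (fst p)) (emb {j, j + 1} (snd p))"

end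

theory Submission
  imports Defs
begin

text \<open>
  Every unit vector of \<open>\<real>\<^sup>m\<close> is a conjugate of \<open>\<plusminus>e\<^sub>m\<close> by a product of elementary rotors
  \<open>cos a + sin a e\<^sub>i e\<^sub>i\<^sub>+\<^sub>1\<close>, and \<open>e\<^sub>m\<close> normalises the group of such products. Hence for
  \<open>m \<ge> 2\<close> this group is \<open>Spin(m)\<close>.

  For universality, the maps of an enveloping group \<open>H\<close> give one homomorphism
  \<open>h\<^sub>i : Spin(2) \<rightarrow> H\<close> per vertex. Let \<open>S\<^sub>i\<close> be the subgroup of pairs
  \<open>(S(a) in the plane i, i+1; h\<^sub>i (S(a)))\<close> of \<open>Spin(n) \<times> H\<close>. Euler angles in \<open>Spin(3)\<close> give
  \<open>S\<^sub>i\<^sub>+\<^sub>1 S\<^sub>i S\<^sub>i\<^sub>+\<^sub>1 \<subseteq> S\<^sub>i S\<^sub>i\<^sub>+\<^sub>1 S\<^sub>i\<close>, and far-apart \<open>S\<^sub>i\<close> commute, so the subgroups generated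
  by the first \<open>k\<close> of them satisfy \<open>\<Gamma>\<^sub>k\<^sub>+\<^sub>1 = \<Gamma>\<^sub>k S\<^sub>k\<^sub>+\<^sub>1 \<Gamma>\<^sub>k\<close>. If \<open>a x b\<close>, written in this
  form, has trivial first component, then the rotor in \<open>x\<close> lies in \<open>Spin(k+1)\<close>, so it is \<open>\<plusminus>1\<close>, so
  \<open>x\<close> lies in \<open>S\<^sub>k\<close> already; descending, \<open>a x b\<close> is trivial. Thus \<open>\<Gamma>\<^sub>n\<^sub>-\<^sub>1\<close> is the graph of the
  required homomorphism.
\<close>

section \<open>The Clifford algebra as a real algebra\<close>

abbreviation sdiff :: "'a set \<Rightarrow> 'a set \<Rightarrow> 'a set" where
  "sdiff S T \<equiv> (S - T) \<union> (T - S)"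

lemma sdiff_left_cancel [simp]: "sdiff S (sdiff S T) = T"
  by auto

text \<open>The factors over \<open>S \<inter> T\<close> occur twice on the right and square to
  1.\<close>

lemma prod_sdiff:
  fixes f :: "'a \<Rightarrow> real"
  assumes "finite S" "finite T" and sq: "\<And>x. f x * f x = 1"
  shows "prod f (sdiff S T) = prod f S * prod f T"
proof -
  have a: "prod f S = prod f (S - T) * prod f (S \<inter> T)"
    using prod.Int_Diff[OF assms(1), of f T] by (simp add: mult.commute)
  have b: "prod f T = prod f (T - S) * prod f (S \<inter> T)"
    using prod.Int_Diff[OF assms(2), of f S] by (simp add: mult.commute Int_commute)
  have c: "prod f (S \<inter> T) * prod f (S \<inter> T) = 1"
    by (simp add: sq flip: prod.distrib)
  have "prod f (sdiff S T) = prod f (S - T) * prod f (T - S)"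
    using assms by (intro prod.union_disjoint) auto
  also have "\<dots> = prod f (S - T) * prod f (T - S) * (prod f (S \<inter> T) * prod f (S \<inter> T))"
    by (simp only: c mult_1_right)
  also have "\<dots> = prod f S * prod f T"
    unfolding a b by (simp only: mult_ac)
  finally show ?thesis .
qed

text \<open>This product form shows that the sign is bimultiplicative for the symmetric difference,
  which is all that associativity needs.\<close>

lemma blade_sign_prod:
  assumes "finite S" "finite T"
  shows "blade_sign S T = (\<Prod>s\<in>S. \<Prod>t\<in>T. if t \<le> s then -1 else 1)"
proof -
  let ?A = "{(s, t). s \<in> S \<and> t \<in> T \<and> t < s}"
  \<comment> \<open>The diagonal pairs account for \<open>card (S \<inter> T)\<close>, so the two
    summands of the exponent together count the pairs with \<open>t \<le> s\<close>.\<close>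
  let ?D = "(\<lambda>s. (s, s)) ` (S \<inter> T)"
  have fA: "finite ?A"
    by (rule finite_subset[of _ "S \<times> T"]) (use assms in auto)
  have eq: "{p \<in> S \<times> T. snd p \<le> fst p} = ?A \<union> ?D"
    by (auto simp: image_iff le_less)
  have "card (?A \<union> ?D) = card ?A + card ?D"
    using fA assms by (intro card_Un_disjoint) auto
  moreover have "card ?D = card (S \<inter> T)"
    by (rule card_image) (auto simp: inj_on_def)
  ultimately have 1: "blade_sign S T = (-1) ^ card {p \<in> S \<times> T. snd p \<le> fst p}"
    unfolding blade_sign_def eq by simp
  have "(\<Prod>s\<in>S. \<Prod>t\<in>T. if t \<le> s then -1 else (1::real))
      = (\<Prod>p\<in>S \<times> T. if snd p \<le> fst p then -1 else 1)"
    by (simp add: prod.cartesian_product case_prod_unfold)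
  also have "\<dots> = (\<Prod>p\<in>{p \<in> S \<times> T. snd p \<le> fst p}. -1)"
    using assms by (subst prod.inter_filter) auto
  finally show ?thesis
    using 1 by simp
qed

lemma blade_sign_sdiff_left:
  assumes "finite S" "finite S'" "finite T"
  shows "blade_sign (sdiff S S') T = blade_sign S T * blade_sign S' T"
proof -
  have "finite (sdiff S S')"
    using assms by simp
  then have "blade_sign (sdiff S S') T = (\<Prod>s\<in>sdiff S S'. \<Prod>t\<in>T. if t \<le> s then -1 else 1)"
    using assms by (simp only: blade_sign_prod)
  also have "\<dots> = (\<Prod>s\<in>S. \<Prod>t\<in>T. if t \<le> s then -1 else 1) * (\<Prod>s\<in>S'. \<Prod>t\<in>T. if t \<le> s then -1 else 1)"
    using assms by (intro prod_sdiff) (auto simp flip: prod.distrib intro!: prod.neutral)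
  finally show ?thesis
    using assms by (simp only: blade_sign_prod)
qed

lemma blade_sign_sdiff_right:
  assumes "finite S" "finite T" "finite T'"
  shows "blade_sign S (sdiff T T') = blade_sign S T * blade_sign S T'"
proof -
  have "blade_sign S (sdiff T T') = (\<Prod>s\<in>S. (\<Prod>t\<in>T. if t \<le> s then -1 else 1) * (\<Prod>t\<in>T'. if t \<le> s then -1 else 1))"
    using assms by (subst blade_sign_prod) (auto intro!: prod.cong prod_sdiff)
  then show ?thesis
    using assms by (simp add: blade_sign_prod prod.distrib)
qed

lemma blade_sign_empty [simp]: "blade_sign {} T = 1" "blade_sign S {} = 1"
  by (simp_all add: blade_sign_def)

section \<open>The type of multivectors of bounded support and its product\<close>

definition supported :: "nat \<Rightarrow> mvec \<Rightarrow> bool" where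
  "supported n f \<longleftrightarrow> (\<forall>S. \<not> S \<subseteq> {1..n} \<longrightarrow> f S = 0)"

lemma supported_mono: "supported m f \<Longrightarrow> m \<le> n \<Longrightarrow> supported n f"
  unfolding supported_def by (meson atLeastatMost_subset_iff order_refl subset_trans)

text \<open>One type for all ranks makes the class-based ring and vector space reasoning available;
  the Clifford algebra on e_1, ..., e_n becomes its subalgebra \<open>lower n\<close>.\<close>

typedef cliff = "{f. \<exists>n. supported n f}" morphisms coef Cliff
  by (rule exI[of _ "\<lambda>_. 0"]) (simp add: supported_def)

definition lower :: "nat \<Rightarrow> cliff set" where
  "lower n = {x. supported n (coef x)}"

lemma lower_zero: "x \<in> lower n \<Longrightarrow> \<not> S \<subseteq> {1..n} \<Longrightarrow> coef x S = 0"
  by (auto simp: lower_def supported_def)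

lemma lower_mono: "x \<in> lower m \<Longrightarrow> m \<le> n \<Longrightarrow> x \<in> lower n"
  by (auto simp: lower_def intro: supported_mono)

lemma lower_ex: "\<exists>n. x \<in> lower n"
  using coef[of x] by (simp add: lower_def)

lemma lower_ex2: "\<exists>n. x \<in> lower n \<and> y \<in> lower n"
  by (meson lower_ex lower_mono nle_le)

lemma coef_Cliff: "supported n f \<Longrightarrow> coef (Cliff f) = f"
  by (rule Cliff_inverse) auto

lemma cliff_eqI: "(\<And>T. coef x T = coef y T) \<Longrightarrow> x = y"
  by (metis coef_inject ext)

instantiation cliff :: real_algebra_1
begin

definition "0 = Cliff (\<lambda>_. 0)"
definition "1 = Cliff cl_one"
definition "x + y = Cliff (\<lambda>T. coef x T + coef y T)"
definition "- x = Cliff (\<lambda>T. - coef x T)"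
definition "x - y = Cliff (\<lambda>T. coef x T - coef y T)" for x y :: cliff
definition "r *\<^sub>R x = Cliff (\<lambda>T. r * coef x T)"
text \<open>Summing over the support of \<open>x\<close> avoids naming a rank; for each
  \<open>S\<close> the target \<open>T\<close> leaves only the partner
  \<open>sdiff S T\<close>.\<close>

definition "x * y = Cliff (\<lambda>T. \<Sum>S | coef x S \<noteq> 0.
  blade_sign S (sdiff S T) * coef x S * coef y (sdiff S T))"

lemma coef_zero [simp]: "coef 0 T = 0"
  unfolding zero_cliff_def by (subst coef_Cliff) (auto simp: supported_def)

lemma coef_one: "coef 1 = cl_one"
  unfolding one_cliff_def by (subst coef_Cliff[of 0]) (auto simp: supported_def cl_one_def)

lemma coef_add [simp]: "coef (x + y) T = coef x T + coef y T"
proof -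
  obtain n where "x \<in> lower n" "y \<in> lower n" using lower_ex2 by blast
  then show ?thesis
    unfolding plus_cliff_def
    by (subst coef_Cliff[of n]) (simp_all add: supported_def lower_def)
qed

lemma coef_uminus [simp]: "coef (- x) T = - coef x T"
proof -
  obtain n where "x \<in> lower n" using lower_ex by blast
  then show ?thesis
    unfolding uminus_cliff_def
    by (subst coef_Cliff[of n]) (simp_all add: supported_def lower_def)
qed

lemma coef_diff [simp]: "coef (x - y) T = coef x T - coef y T"
proof -
  obtain n where "x \<in> lower n" "y \<in> lower n" using lower_ex2 by blast
  then show ?thesis
    unfolding minus_cliff_def
    by (subst coef_Cliff[of n]) (simp_all add: supported_def lower_def)
qed

lemma coef_scaleR [simp]: "coef (r *\<^sub>R x) T = r * coef x T"
proof -
  obtain n where "x \<in> lower n" using lower_ex by blast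
  then show ?thesis
    unfolding scaleR_cliff_def
    by (subst coef_Cliff[of n]) (simp_all add: supported_def lower_def)
qed

lemma sum_lower:
  assumes "x \<in> lower n"
  shows "(\<Sum>S | coef x S \<noteq> 0. g S * coef x S * h S) = (\<Sum>S\<in>Pow {1..n}. g S * coef x S * h S)"
  using assms by (intro sum.mono_neutral_left) (auto simp: lower_def supported_def)

lemma sdiff_subset_iff: "S \<subseteq> A \<Longrightarrow> sdiff S T \<subseteq> A \<longleftrightarrow> T \<subseteq> A"
  by auto

text \<open>For \<open>S\<close> inside \<open>{1..n}\<close>, the set \<open>sdiff S T\<close>
  leaves \<open>{1..n}\<close> exactly when \<open>T\<close> does. So a common bound of the factors
  also bounds the product, and the sum may run over all of \<open>Pow {1..n}\<close>.\<close>

lemma coef_mult_aux: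
  assumes "x \<in> lower n" "y \<in> lower n"
  shows "coef (x * y) T = (\<Sum>S\<in>Pow {1..n}. blade_sign S (sdiff S T) * coef x S * coef y (sdiff S T))"
    and "x * y \<in> lower n"
proof -
  let ?f = "\<lambda>T. \<Sum>S\<in>Pow {1..n}. blade_sign S (sdiff S T) * coef x S * coef y (sdiff S T)"
  have y0: "coef y (sdiff S T) = 0" if "S \<subseteq> {1..n}" "\<not> T \<subseteq> {1..n}" for S T
    by (intro lower_zero[OF assms(2)]) (simp only: sdiff_subset_iff[OF that(1)] that(2) not_False_eq_True)
  then have s: "supported n ?f"
    unfolding supported_def by (intro allI impI sum.neutral ballI) (simp only: Pow_iff y0 mult_zero_right not_False_eq_True)
  have "x * y = Cliff ?f"
    unfolding times_cliff_def by (simp only: sum_lower[OF assms(1)])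
  then have "coef (x * y) = ?f"
    using s by (simp only: coef_Cliff)
  then show "coef (x * y) T = ?f T" "x * y \<in> lower n"
    using s by (simp_all only: lower_def mem_Collect_eq)
qed

text \<open>Both sides are double sums over triples of blades with total symmetric difference
  \<open>T\<close>. They are matched by exchanging the blade \<open>S\<close> of
  \<open>x * y\<close> for the blade \<open>V = sdiff U S\<close> of \<open>y\<close>; the signs
  agree by bimultiplicativity.\<close>

lemma mult_assoc_cliff: "(x * y) * z = x * (y * (z::cliff))"
proof (rule cliff_eqI)
  fix T
  obtain n where n: "x \<in> lower n" "y \<in> lower n" "z \<in> lower n"
    by (metis lower_ex lower_mono nle_le)
  \<comment> \<open>\<open>a1\<close> cancels the sign of \<open>U\<close> against
    \<open>sdiff S T\<close>, which both expansions produce; \<open>a2\<close> carries the resulting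
    identity through the three coefficients.\<close>
  have a1: "p * b = c * d" if "p = d * q" "b = q * c" "q * q = 1" for p b c d q :: real
  proof -
    have "p * b = (q * q) * (c * d)"
      unfolding that(1,2) by (simp only: mult_ac)
    then show ?thesis
      by (simp only: that(3) mult_1_left)
  qed
  have a2: "p * u * (b * v * w) = c * (d * u * v) * w" if "p * b = c * d" for p b c d u v w :: real
  proof -
    have "p * u * (b * v * w) = (p * b) * (u * v * w)"
      by (simp only: mult_ac)
    also have "\<dots> = c * (d * u * v) * w"
      unfolding that by (simp only: mult_ac)
    finally show ?thesis .
  qed
  let ?P = "Pow {1..n::nat}"
  have "coef ((x * y) * z) T = (\<Sum>S\<in>?P. blade_sign S (sdiff S T) *
      (\<Sum>U\<in>?P. blade_sign U (sdiff U S) * coef x U * coef y (sdiff U S)) * coef z (sdiff S T))"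
    using n by (simp only: coef_mult_aux[of _ n])
  also have "\<dots> = (\<Sum>S\<in>?P. \<Sum>U\<in>?P. blade_sign S (sdiff S T) *
      (blade_sign U (sdiff U S) * coef x U * coef y (sdiff U S)) * coef z (sdiff S T))"
    by (simp only: sum_distrib_left sum_distrib_right)
  also have "\<dots> = (\<Sum>U\<in>?P. \<Sum>S\<in>?P. blade_sign S (sdiff S T) *
      (blade_sign U (sdiff U S) * coef x U * coef y (sdiff U S)) * coef z (sdiff S T))"
    by (rule sum.swap)
  also have "\<dots> = (\<Sum>U\<in>?P. blade_sign U (sdiff U T) * coef x U *
      (\<Sum>V\<in>?P. blade_sign V (sdiff V (sdiff U T)) * coef y V * coef z (sdiff V (sdiff U T))))"
  proof (rule sum.cong[OF refl])
    fix U assume U: "U \<in> ?P"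
    have "(\<Sum>S\<in>?P. blade_sign S (sdiff S T) *
        (blade_sign U (sdiff U S) * coef x U * coef y (sdiff U S)) * coef z (sdiff S T))
      = (\<Sum>V\<in>?P. blade_sign U (sdiff U T) * coef x U *
        (blade_sign V (sdiff V (sdiff U T)) * coef y V * coef z (sdiff V (sdiff U T))))"
    proof (rule sum.reindex_bij_witness[of _ "sdiff U" "sdiff U"])
      fix S assume S: "S \<in> ?P"
      show "sdiff U S \<in> ?P" using S U by blast
      then have V: "sdiff U S \<in> ?P" .
      have zz: "sdiff (sdiff U S) (sdiff U T) = sdiff S T" by auto
      \<comment> \<open>Bimultiplicativity needs finite sets and \<open>T\<close> may be infinite.
        Where the coefficient of \<open>z\<close> does not vanish, its index lies in
        \<open>{1..n}\<close>; elsewhere both terms are zero.\<close>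
      have "blade_sign U (sdiff U T) * blade_sign (sdiff U S) (sdiff S T)
          = blade_sign S (sdiff S T) * blade_sign U (sdiff U S)" if "coef z (sdiff S T) \<noteq> 0"
      proof -
        have "sdiff S T \<subseteq> {1..n}" by (rule ccontr) (use that lower_zero[OF n(3), of "sdiff S T"] in simp)
        then have f: "finite (sdiff S T)" by (rule finite_subset) simp
        have g: "finite U" "finite S" "finite (sdiff U S)"
          using U S finite_subset[of U "{1..n}"] finite_subset[of S "{1..n}"] by simp_all
        have e: "sdiff U T = sdiff (sdiff U S) (sdiff S T)" by auto
        have "blade_sign U (sdiff U T) = blade_sign U (sdiff U S) * blade_sign U (sdiff S T)"
          by (subst e, rule blade_sign_sdiff_right) (use f g in auto)
        moreover have "blade_sign (sdiff U S) (sdiff S T) = blade_sign U (sdiff S T) * blade_sign S (sdiff S T)"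
          by (rule blade_sign_sdiff_left) (use f g in auto)
        moreover have "blade_sign U (sdiff S T) * blade_sign U (sdiff S T) = 1"
          using g f by (simp only: blade_sign_prod flip: prod.distrib) (auto intro!: prod.neutral)
        ultimately show ?thesis by (rule a1)
      qed
      then show "blade_sign U (sdiff U T) * coef x U *
        (blade_sign (sdiff U S) (sdiff (sdiff U S) (sdiff U T)) * coef y (sdiff U S) *
          coef z (sdiff (sdiff U S) (sdiff U T)))
        = blade_sign S (sdiff S T) *
        (blade_sign U (sdiff U S) * coef x U * coef y (sdiff U S)) * coef z (sdiff S T)"
        unfolding zz by (cases "coef z (sdiff S T) = 0") (simp, rule a2, simp only: simp_thms)
    qed (use U in auto)
    then show "(\<Sum>S\<in>?P. blade_sign S (sdiff S T) *
        (blade_sign U (sdiff U S) * coef x U * coef y (sdiff U S)) * coef z (sdiff S T))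
      = blade_sign U (sdiff U T) * coef x U *
      (\<Sum>V\<in>?P. blade_sign V (sdiff V (sdiff U T)) * coef y V * coef z (sdiff V (sdiff U T)))"
      by (simp only: sum_distrib_left)
  qed
  also have "\<dots> = coef (x * (y * z)) T"
    using n by (simp only: coef_mult_aux[of _ n])
  finally show "coef ((x * y) * z) T = coef (x * (y * z)) T" .
qed

instance
proof
  fix a b c :: cliff and r s :: real
  show "a + b + c = a + (b + c)" "a + b = b + a" "0 + a = a" "- a + a = 0" "a - b = a + - b"
    "r *\<^sub>R (a + b) = r *\<^sub>R a + r *\<^sub>R b" "(r + s) *\<^sub>R a = r *\<^sub>R a + s *\<^sub>R a"
    "r *\<^sub>R s *\<^sub>R a = (r * s) *\<^sub>R a" "1 *\<^sub>R a = a"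
    by (rule cliff_eqI, simp add: algebra_simps)+
  show "a * b * c = a * (b * c)" by (rule mult_assoc_cliff)
  obtain n where n: "a \<in> lower n" "b \<in> lower n" "c \<in> lower n"
    by (metis lower_ex lower_mono nle_le)
  have l: "a + b \<in> lower n" "b + c \<in> lower n" "r *\<^sub>R a \<in> lower n" "r *\<^sub>R b \<in> lower n" "(1::cliff) \<in> lower n"
    using n by (simp_all add: lower_def supported_def coef_one cl_one_def)
  show "(a + b) * c = a * c + b * c"
    by (rule cliff_eqI)
      (use n l in \<open>simp only: coef_mult_aux[of _ n] coef_add distrib_left distrib_right sum.distrib\<close>)
  show "a * (b + c) = a * b + a * c"
    by (rule cliff_eqI)
      (use n l in \<open>simp only: coef_mult_aux[of _ n] coef_add distrib_left distrib_right sum.distrib\<close>)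
  show "r *\<^sub>R a * b = r *\<^sub>R (a * b)"
    by (rule cliff_eqI)
      (use n l in \<open>simp add: coef_mult_aux[of _ n] mult_ac sum_distrib_left\<close>)
  show "a * r *\<^sub>R b = r *\<^sub>R (a * b)"
    by (rule cliff_eqI)
      (use n l in \<open>simp add: coef_mult_aux[of _ n] mult_ac sum_distrib_left\<close>)
  have if1: "p * (if Q then 1 else 0) * q = (if Q then p * q else 0)" for p q :: real and Q
    by simp
  have if2: "p * q * (if Q then 1 else 0) = (if Q then p * q else 0)" for p q :: real and Q
    by simp
  show "1 * a = a"
    by (rule cliff_eqI)
      (use n l in \<open>simp add: coef_mult_aux[of _ n] coef_one cl_one_def if1 sum.delta\<close>)
  show "a * 1 = a"
  proof (rule cliff_eqI)
    fix T :: "nat set"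
    have "sdiff S T = {} \<longleftrightarrow> S = T" for S by auto
    then have "coef (a * 1) T = (\<Sum>S\<in>Pow {1..n}. if S = T then blade_sign S (sdiff S T) * coef a S else 0)"
      using n l by (simp add: coef_mult_aux[of _ n] coef_one cl_one_def if2)
    then show "coef (a * 1) T = coef a T"
      using lower_zero[OF n(1), of T] by (auto simp: sum.delta)
  qed
  show "(0::cliff) \<noteq> 1"
  proof
    assume "(0::cliff) = 1"
    then have "coef 0 {} = coef 1 {}" by simp
    then show False by (simp add: coef_one cl_one_def)
  qed
qed

end

lemmas coef_mult = coef_mult_aux(1)

lemma lower_intros [intro, simp]:
  "0 \<in> lower n" "1 \<in> lower n"
  "x \<in> lower n \<Longrightarrow> y \<in> lower n \<Longrightarrow> x + y \<in> lower n"
  "x \<in> lower n \<Longrightarrow> y \<in> lower n \<Longrightarrow> x * y \<in> lower n"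
  "x \<in> lower n \<Longrightarrow> r *\<^sub>R x \<in> lower n"
  by (simp_all add: coef_mult_aux(2)) (auto simp: lower_def supported_def coef_one cl_one_def)

text \<open>Transfers the ring product to the multiplication of \<open>spin_grp\<close>. For fixed
  \<open>S\<close> and \<open>T\<close> only \<open>S' = sdiff S T\<close> can contribute, and if
  that set leaves \<open>{1..n}\<close> the coefficient of \<open>y\<close> is zero.\<close>

lemma coef_mult_cl_mult:
  assumes "x \<in> lower n" "y \<in> lower n"
  shows "coef (x * y) = cl_mult n (coef x) (coef y)"
proof
  fix T
  have "(\<Sum>S'\<in>Pow {1..n}. if sdiff S S' = T then blade_sign S S' * coef x S * coef y S' else 0)
      = blade_sign S (sdiff S T) * coef x S * coef y (sdiff S T)" if "S \<subseteq> {1..n}" for S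
  proof -
    have "sdiff S S' = T \<longleftrightarrow> S' = sdiff S T" for S' by auto
    then show ?thesis
      using lower_zero[OF assms(2), of "sdiff S T"] by (simp add: sum.delta)
  qed
  then show "coef (x * y) T = cl_mult n (coef x) (coef y) T"
    using assms by (simp add: coef_mult[of _ n] cl_mult_def)
qed

lemma coef_sum: "coef (sum f A) T = (\<Sum>i\<in>A. coef (f i) T)"
  by (induction A rule: infinite_finite_induct) auto

section \<open>Basis blades, generators and the Clifford relations\<close>

definition blade :: "nat set \<Rightarrow> cliff" where
  "blade S = Cliff (\<lambda>T. if T = S then 1 else 0)"

lemma coef_blade:
  assumes "S \<subseteq> {1..n}"
  shows "coef (blade S) T = (if T = S then 1 else 0)"
  unfolding blade_def using assms by (subst coef_Cliff[of n]) (auto simp: supported_def)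

lemma blade_lower: "S \<subseteq> {1..n} \<Longrightarrow> blade S \<in> lower n"
  by (auto simp: lower_def supported_def coef_blade split: if_splits)

lemma blade_empty: "blade {} = 1"
  by (rule cliff_eqI) (simp add: coef_blade coef_one cl_one_def)

lemma blade_mult:
  assumes "S \<subseteq> {1..n}" "T \<subseteq> {1..n}"
  shows "blade S * blade T = blade_sign S T *\<^sub>R blade (sdiff S T)"
proof (rule cliff_eqI)
  fix V
  have if1: "p * (if Q then 1 else 0) * q = (if Q then p * q else 0)" for p q :: real and Q
    by simp
  have s: "sdiff S T \<subseteq> {1..n}" using assms by auto
  have e: "sdiff S V = T \<longleftrightarrow> V = sdiff S T" by auto
  show "coef (blade S * blade T) V = coef (blade_sign S T *\<^sub>R blade (sdiff S T)) V"
    using assms s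
    by (simp add: coef_mult[OF blade_lower blade_lower] coef_blade[OF assms(1)] coef_blade[OF assms(2)]
        coef_blade[OF s] if1 sum.delta e)
qed

definition gen :: "nat \<Rightarrow> cliff" where
  "gen k = blade {k}"

lemma gen_lower [intro]: "1 \<le> k \<Longrightarrow> k \<le> n \<Longrightarrow> gen k \<in> lower n"
  by (auto simp: gen_def intro: blade_lower)

lemma blade_sign_singletons: "blade_sign {k} {l} = (if l \<le> k then -1 else 1)"
  by (simp add: blade_sign_prod)

lemma gen_square: "1 \<le> k \<Longrightarrow> gen k * gen k = -1"
  unfolding gen_def by (subst blade_mult[of _ k]) (auto simp: blade_sign_singletons blade_empty)

lemma gen_anticommute: "1 \<le> k \<Longrightarrow> 1 \<le> l \<Longrightarrow> k \<noteq> l \<Longrightarrow> gen k * gen l = - (gen l * gen k)"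
  unfolding gen_def
  by (subst (1 2) blade_mult[of _ "max k l"]) (auto simp: blade_sign_singletons insert_commute Un_commute)

section \<open>Elementary rotors\<close>

definition biv :: "nat \<Rightarrow> cliff" where
  "biv i = gen i * gen (Suc i)"

definition rot :: "nat \<Rightarrow> real \<Rightarrow> cliff" where
  "rot i a = cos a *\<^sub>R 1 + sin a *\<^sub>R biv i"

text \<open>The elements \<open>biv i\<close>, \<open>biv (Suc i)\<close> and their product multiply
  like the quaternion units, so these are the quaternions in the even subalgebra on e_i, e_(i+1),
  e_(i+2).\<close>

definition quat :: "nat \<Rightarrow> real \<Rightarrow> real \<Rightarrow> real \<Rightarrow> real \<Rightarrow> cliff" where
  "quat i p q r s = p *\<^sub>R 1 + q *\<^sub>R biv i + r *\<^sub>R biv (Suc i) + s *\<^sub>R (biv i * biv (Suc i))"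

lemma biv_square:
  assumes "1 \<le> i"
  shows "biv i * biv i = -1"
proof -
  have "biv i * biv i = gen i * (gen (Suc i) * gen i) * gen (Suc i)"
    by (simp add: biv_def mult.assoc)
  also have "gen (Suc i) * gen i = - (gen i * gen (Suc i))"
    using assms by (intro gen_anticommute) auto
  also have "gen i * - (gen i * gen (Suc i)) * gen (Suc i) = - ((gen i * gen i) * (gen (Suc i) * gen (Suc i)))"
    by (simp add: mult.assoc)
  finally show ?thesis
    using assms by (simp add: gen_square)
qed

text \<open>Passing the two generators of the bivector costs two signs, which cancel.\<close>

lemma gen_biv_commute:
  assumes "1 \<le> k" "1 \<le> i" "k \<noteq> i" "k \<noteq> Suc i"
  shows "gen k * biv i = biv i * gen k"
proof -
  have "gen k * biv i = (gen k * gen i) * gen (Suc i)"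
    by (simp add: biv_def mult.assoc)
  also have "gen k * gen i = - (gen i * gen k)"
    using assms by (intro gen_anticommute) auto
  also have "- (gen i * gen k) * gen (Suc i) = - (gen i * (gen k * gen (Suc i)))"
    by (simp add: mult.assoc)
  also have "gen k * gen (Suc i) = - (gen (Suc i) * gen k)"
    using assms by (intro gen_anticommute) auto
  finally show ?thesis
    by (simp add: biv_def mult.assoc)
qed

lemma gen_Suc_biv:
  assumes "1 \<le> i"
  shows "gen (Suc i) * biv i = - (biv i * gen (Suc i))"
proof -
  have "gen (Suc i) * biv i = (gen (Suc i) * gen i) * gen (Suc i)"
    by (simp add: biv_def mult.assoc)
  also have "gen (Suc i) * gen i = - (gen i * gen (Suc i))"
    using assms by (intro gen_anticommute) auto
  finally show ?thesis
    by (simp add: biv_def)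
qed

lemma biv_commute:
  assumes "1 \<le> i" "Suc i < j"
  shows "biv i * biv j = biv j * biv i"
proof -
  have 1: "gen j * biv i = biv i * gen j" "gen (Suc j) * biv i = biv i * gen (Suc j)"
    using assms by (auto intro: gen_biv_commute)
  have "biv j * biv i = gen j * (gen (Suc j) * biv i)"
    by (simp add: biv_def[of j] mult.assoc)
  also have "\<dots> = gen j * biv i * gen (Suc j)"
    by (simp only: 1(2) mult.assoc)
  also have "\<dots> = biv i * biv j"
    by (simp only: 1(1) biv_def[of j] mult.assoc[symmetric])
  finally show ?thesis ..
qed

lemma biv_anticommute:
  assumes "1 \<le> i"
  shows "biv (Suc i) * biv i = - (biv i * biv (Suc i))"
proof -
  have 1: "gen (Suc i) * biv i = - (biv i * gen (Suc i))"
    using assms by (rule gen_Suc_biv)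
  have 2: "gen (Suc (Suc i)) * biv i = biv i * gen (Suc (Suc i))"
    using assms by (intro gen_biv_commute) auto
  have "biv (Suc i) * biv i = gen (Suc i) * (gen (Suc (Suc i)) * biv i)"
    by (simp add: biv_def[of "Suc i"] mult.assoc)
  also have "\<dots> = (gen (Suc i) * biv i) * gen (Suc (Suc i))"
    by (simp only: 2 mult.assoc)
  also have "\<dots> = - (biv i * biv (Suc i))"
    by (simp add: 1 mult.assoc biv_def[of "Suc i"])
  finally show ?thesis .
qed

lemma quat_mult:
  assumes "1 \<le> i"
  shows "quat i p q r s * quat i p' q' r' s' = quat i (p*p' - q*q' - r*r' - s*s')
    (p*q' + q*p' + r*s' - s*r') (p*r' - q*s' + r*p' + s*q') (p*s' + q*r' - r*q' + s*p')"
proof -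
  define I J where "I = biv i" and "J = biv (Suc i)"
  have II: "I * I = -1" "J * J = -1" and JI: "J * I = - (I * J)"
    unfolding I_def J_def using assms biv_square biv_anticommute by auto
  \<comment> \<open>The relations in right-nested form, moving \<open>J\<close> behind
    \<open>I\<close>, reduce every monomial to \<open>1\<close>, \<open>I\<close>, \<open>J\<close>
    or \<open>I * J\<close> up to sign.\<close>
  have assoc: "I * (I * x) = - x" "J * (J * x) = - x" "J * (I * x) = - (I * (J * x))" for x
    by (simp_all add: II JI flip: mult.assoc)
  show ?thesis
    unfolding quat_def I_def[symmetric] J_def[symmetric]
    by (simp add: algebra_simps II JI assoc)
qed

lemma rot_quat: "rot i a = quat i (cos a) (sin a) 0 0" "rot (Suc i) a = quat i (cos a) 0 (sin a) 0"
  by (simp_all add: rot_def quat_def)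

lemma rot_mult: "1 \<le> i \<Longrightarrow> rot i a * rot i b = rot i (a + b)"
  unfolding rot_quat(1) by (simp add: quat_mult cos_add sin_add algebra_simps)

lemma rot_0 [simp]: "rot i 0 = 1"
  by (simp add: rot_def)

lemma rot_pi: "rot i pi = -1"
  by (simp add: rot_def)

lemma rot_inverse: "1 \<le> i \<Longrightarrow> rot i a * rot i (-a) = 1" "1 \<le> i \<Longrightarrow> rot i (-a) * rot i a = 1"
  by (simp_all add: rot_mult)

lemma rot_commute:
  assumes "1 \<le> i" "Suc i < j"
  shows "rot i a * rot j b = rot j b * rot i a"
  by (simp add: rot_def algebra_simps biv_commute[OF assms])

text \<open>In polar form the coordinate pairs \<open>(p, q)\<close> and \<open>(r, s)\<close> have
  radii \<open>cos b\<close> and \<open>sin b\<close>. In the product of three rotors their phases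
  are \<open>a + c\<close> and \<open>a - c\<close>, so half the sum and half the difference of the
  phases give \<open>a\<close> and \<open>c\<close>.\<close>

lemma euler_angles:
  assumes "1 \<le> i" "p\<^sup>2 + q\<^sup>2 + r\<^sup>2 + s\<^sup>2 = 1"
  shows "\<exists>a b c. quat i p q r s = rot i a * rot (Suc i) b * rot i c"
proof -
  obtain u t where ut: "p = u * cos t" "q = u * sin t"
    using polar_Ex by blast
  obtain v t' where vt: "r = v * cos t'" "s = v * sin t'"
    using polar_Ex by blast
  have "u\<^sup>2 = u\<^sup>2 * ((cos t)\<^sup>2 + (sin t)\<^sup>2)" "v\<^sup>2 = v\<^sup>2 * ((cos t')\<^sup>2 + (sin t')\<^sup>2)"
    by simp_all
  then have "u\<^sup>2 + v\<^sup>2 = p\<^sup>2 + q\<^sup>2 + r\<^sup>2 + s\<^sup>2"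
    unfolding ut vt by (simp only: power_mult_distrib distrib_left)
  then obtain b where b: "u = cos b" "v = sin b"
    using assms(2) sincos_total_2pi[of u v] by metis
  let ?a = "(t + t') / 2" and ?c = "(t - t') / 2"
  have sc: "t = ?a + ?c" "t' = ?a - ?c"
    by (simp_all add: field_simps)
  have "rot i ?a * rot (Suc i) b * rot i ?c
      = quat i (cos b * cos (?a + ?c)) (cos b * sin (?a + ?c)) (sin b * cos (?a - ?c)) (sin b * sin (?a - ?c))"
    unfolding rot_quat(1)[of i] rot_quat(2) quat_mult[OF assms(1)]
    by (simp add: cos_add sin_add cos_diff sin_diff algebra_simps)
  then have "rot i ?a * rot (Suc i) b * rot i ?c = quat i p q r s"
    unfolding sc[symmetric] ut vt b .
  then show ?thesis
    by metis
qed

text \<open>The left product is a unit quaternion, and every unit quaternion has Euler angles for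
  the other order of the two axes.\<close>

lemma rot_braid:
  assumes "1 \<le> i"
  shows "\<exists>a' b' c'. rot (Suc i) a * rot i b * rot (Suc i) c = rot i a' * rot (Suc i) b' * rot i c'"
proof -
  have "rot (Suc i) a * rot i b * rot (Suc i) c
      = quat i (cos b * cos (a + c)) (sin b * cos (c - a)) (cos b * sin (a + c)) (sin b * sin (c - a))"
    unfolding rot_quat(1)[of i] rot_quat(2) quat_mult[OF assms(1)]
    by (simp add: cos_add sin_add cos_diff sin_diff algebra_simps)
  moreover have "(cos b * cos (a + c))\<^sup>2 + (sin b * cos (c - a))\<^sup>2 + (cos b * sin (a + c))\<^sup>2 + (sin b * sin (c - a))\<^sup>2
      = (cos b)\<^sup>2 * ((cos (a + c))\<^sup>2 + (sin (a + c))\<^sup>2) + (sin b)\<^sup>2 * ((cos (c - a))\<^sup>2 + (sin (c - a))\<^sup>2)"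
    by (simp only: power_mult_distrib distrib_left)
  ultimately show ?thesis
    using euler_angles[OF assms] by simp
qed

lemma biv_blade:
  assumes "1 \<le> i"
  shows "biv i = blade {i, Suc i}"
proof -
  have "sdiff {i} {Suc i} = {i, Suc i}" by auto
  then show ?thesis
    unfolding biv_def gen_def using assms
    by (subst blade_mult[of _ "Suc i"]) (auto simp: blade_sign_singletons)
qed

lemma biv_mult_biv_blade:
  assumes "1 \<le> i"
  shows "biv i * biv (Suc i) = - blade {i, Suc (Suc i)}"
proof -
  have "biv i * biv (Suc i) = gen i * (gen (Suc i) * gen (Suc i)) * gen (Suc (Suc i))"
    by (simp add: biv_def mult.assoc)
  also have "\<dots> = - (gen i * gen (Suc (Suc i)))"
    using assms by (simp add: gen_square)
  also have "gen i * gen (Suc (Suc i)) = blade {i, Suc (Suc i)}"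
  proof -
    have "sdiff {i} {Suc (Suc i)} = {i, Suc (Suc i)}" by auto
    then show ?thesis
      unfolding gen_def using assms
      by (subst blade_mult[of _ "Suc (Suc i)"]) (auto simp: blade_sign_singletons)
  qed
  finally show ?thesis .
qed

lemma coef_rot_biv: "1 \<le> i \<Longrightarrow> coef (rot i a) {i, Suc i} = sin a"
  by (simp add: rot_def coef_one cl_one_def biv_blade coef_blade[of _ "Suc i"])

lemma rot_lower: "1 \<le> i \<Longrightarrow> i < m \<Longrightarrow> rot i a \<in> lower m"
  unfolding rot_def biv_def by (intro lower_intros gen_lower) auto

section \<open>The group of products of elementary rotors\<close>

inductive_set rotors :: "nat \<Rightarrow> cliff set" for m where
  one: "1 \<in> rotors m"
| step: "x \<in> rotors m \<Longrightarrow> 1 \<le> i \<Longrightarrow> i < m \<Longrightarrow> rot i a * x \<in> rotors m"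

lemma rot_rotors: "1 \<le> i \<Longrightarrow> i < m \<Longrightarrow> rot i a \<in> rotors m"
  using rotors.step[OF rotors.one] by simp

lemma rotors_mult: "x \<in> rotors m \<Longrightarrow> y \<in> rotors m \<Longrightarrow> x * y \<in> rotors m"
  by (induction rule: rotors.induct) (auto simp: mult.assoc intro: rotors.step)

lemma rotors_inverse: "x \<in> rotors m \<Longrightarrow> \<exists>y\<in>rotors m. x * y = 1 \<and> y * x = 1"
proof (induction rule: rotors.induct)
  case one
  then show ?case by (auto intro: rotors.one)
next
  case (step x i a)
  then obtain y where y: "y \<in> rotors m" "x * y = 1" "y * x = 1" by blast
  have "rot i a * x * (y * rot i (-a)) = rot i a * (x * y) * rot i (-a)"
    "y * rot i (-a) * (rot i a * x) = y * (rot i (-a) * rot i a) * x"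
    by (simp_all only: mult.assoc)
  then show ?case
    using y step by (intro bexI[of _ "y * rot i (-a)"]) (simp_all add: rot_inverse rotors_mult rot_rotors)
qed

lemma rotors_lower: "x \<in> rotors m \<Longrightarrow> x \<in> lower m"
  by (induction rule: rotors.induct) (simp_all add: rot_lower)

lemma rotors_mono: "x \<in> rotors m \<Longrightarrow> m \<le> n \<Longrightarrow> x \<in> rotors n"
  by (induction rule: rotors.induct) (auto intro: rotors.intros)

lemma rotors_uminus:
  assumes "2 \<le> m" "x \<in> rotors m"
  shows "- x \<in> rotors m"
  \<comment> \<open>The sign is the elementary rotor of angle \<open>pi\<close> in the first plane,
    which exists once \<open>m \<ge> 2\<close>.\<close>
  using rotors.step[OF assms(2), of 1 pi] assms(1) by (simp add: rot_pi)

lemma gen_rotors_commute: "x \<in> rotors m \<Longrightarrow> m < k \<Longrightarrow> gen k * x = x * gen k"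
proof (induction rule: rotors.induct)
  case (step x i a)
  then have "gen k * rot i a = rot i a * gen k"
    by (simp add: rot_def algebra_simps gen_biv_commute)
  then show ?case
    using step by (metis mult.assoc)
qed simp

lemma gen_Suc_rot:
  assumes "1 \<le> i"
  shows "gen (Suc i) * rot i a = rot i (-a) * gen (Suc i)"
  using gen_Suc_biv[OF assms] by (simp add: rot_def algebra_simps)

text \<open>Conjugation by e_m reverses the angle in the last plane \<open>m - 1, m\<close> and
  fixes the elementary rotors of all other planes.\<close>

lemma gen_normalizes_rotors: "x \<in> rotors m \<Longrightarrow> \<exists>y\<in>rotors m. gen m * x = y * gen m"
proof (induction rule: rotors.induct)
  case one
  show ?case by (intro bexI[of _ 1] rotors.one) simp
next
  case (step x i a)
  then obtain y where y: "y \<in> rotors m" "gen m * x = y * gen m" by blast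
  have "\<exists>b. gen m * rot i a = rot i b * gen m"
  proof (cases "m = Suc i")
    case True
    then show ?thesis
      using gen_Suc_rot step by blast
  next
    case False
    then have "gen m * rot i a = rot i a * gen m"
      using step by (simp add: rot_def algebra_simps gen_biv_commute)
    then show ?thesis by blast
  qed
  then obtain b where "gen m * rot i a = rot i b * gen m" by blast
  then have "gen m * (rot i a * x) = (rot i b * y) * gen m"
    using y by (metis mult.assoc)
  then show ?case
    using y step by (intro bexI[of _ "rot i b * y"]) (simp_all add: rotors.step)
qed

section \<open>Spin groups are generated by elementary rotors\<close>

definition vec :: "nat \<Rightarrow> (nat \<Rightarrow> real) \<Rightarrow> cliff" where
  "vec m c = (\<Sum>k=1..m. c k *\<^sub>R gen k)"

lemma coef_gen: "1 \<le> k \<Longrightarrow> coef (gen k) T = (if T = {k} then 1 else 0)"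
  by (simp add: gen_def coef_blade[of _ k])

lemma coef_vec: "coef (vec m c) = cl_vec m c"
proof
  fix T
  have *: "coef (vec m c) T = (\<Sum>k=1..m. if T = {k} then c k else 0)"
    unfolding vec_def by (auto simp: coef_sum coef_gen intro!: sum.cong)
  show "coef (vec m c) T = cl_vec m c T"
  proof (cases "\<exists>k\<in>{1..m}. T = {k}")
    case True
    then obtain k where "k \<in> {1..m}" "T = {k}" by blast
    then show ?thesis
      unfolding * cl_vec_def by simp
  next
    case False
    then show ?thesis
      unfolding * cl_vec_def by (auto intro!: sum.neutral)
  qed
qed

lemma vec_lower: "vec m c \<in> lower m"
  unfolding vec_def
proof -
  have "(\<Sum>k\<in>A. c k *\<^sub>R gen k) \<in> lower m" if "finite A" "A \<subseteq> {1..m}" for A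
    using that by (induction A rule: finite_induct) (auto intro!: lower_intros gen_lower)
  then show "(\<Sum>k=1..m. c k *\<^sub>R gen k) \<in> lower m" by simp
qed

text \<open>Each induction step uses a rotor of the plane \<open>m, m + 1\<close> to turn e_(m+1)
  into the direction given by the previous radius and the new coordinate. The radius may be
  negative, hence only its square is fixed.\<close>

lemma vec_conjugate:
  assumes "1 \<le> m"
  shows "\<exists>\<rho>. \<exists>g\<in>rotors m. \<exists>h\<in>rotors m. g * h = 1 \<and> \<rho>\<^sup>2 = (\<Sum>k=1..m. (c k)\<^sup>2) \<and>
    vec m c = \<rho> *\<^sub>R (g * gen m * h)"
  using assms
proof (induction m rule: dec_induct)
  case base
  show ?case
    by (rule exI[of _ "c 1"], rule bexI[of _ 1], rule bexI[of _ 1]) (auto simp: vec_def intro: rotors.one)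
next
  case (step m)
  then obtain \<rho> g h where gh: "g \<in> rotors m" "h \<in> rotors m" "g * h = 1"
    and \<rho>: "\<rho>\<^sup>2 = (\<Sum>k=1..m. (c k)\<^sup>2)" and v: "vec m c = \<rho> *\<^sub>R (g * gen m * h)"
    by blast
  obtain r t where rt: "\<rho> = r * cos t" "c (Suc m) = r * sin t"
    using polar_Ex by blast
  \<comment> \<open>Conjugation by \<open>rot m a\<close> turns its plane through
    \<open>2 * a\<close>. Since e_(m+1) has to reach the angle \<open>t\<close> measured from e_m,
    this must be \<open>t - pi / 2\<close>.\<close>
  define a where "a = (t - pi / 2) / 2"
  let ?R = "rot m a" and ?R' = "rot m (-a)"
  have a2: "a + a = t - pi / 2"
    by (simp add: a_def)
  have bg: "biv m * gen (Suc m) = - gen m"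
    using step by (simp add: biv_def mult.assoc gen_square)
  have "?R * gen (Suc m) * ?R' = ?R * (rot m a * gen (Suc m))"
    using gen_Suc_rot[of m "-a"] step by (simp add: mult.assoc)
  also have "\<dots> = rot m (t - pi / 2) * gen (Suc m)"
    using rot_mult[of m a a] step by (simp only: a2 flip: mult.assoc)
  also have "\<dots> = cos t *\<^sub>R gen m + sin t *\<^sub>R gen (Suc m)"
    by (simp add: rot_def algebra_simps bg cos_diff sin_diff)
  finally have R: "?R * gen (Suc m) * ?R' = cos t *\<^sub>R gen m + sin t *\<^sub>R gen (Suc m)" .
  \<comment> \<open>The conjugation from the induction hypothesis involves only e_1, ..., e_m and
    therefore fixes e_(m+1).\<close>
  have "g * gen (Suc m) * h = gen (Suc m)"
    using gen_rotors_commute[OF gh(1), of "Suc m"] gh(3) by (metis lessI mult.assoc mult.right_neutral)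
  then have "vec (Suc m) c = \<rho> *\<^sub>R (g * gen m * h) + c (Suc m) *\<^sub>R (g * gen (Suc m) * h)"
    using v by (simp add: vec_def)
  also have "\<dots> = r *\<^sub>R (g * (cos t *\<^sub>R gen m + sin t *\<^sub>R gen (Suc m)) * h)"
    unfolding rt by (simp add: algebra_simps)
  also have "\<dots> = r *\<^sub>R ((g * ?R) * gen (Suc m) * (?R' * h))"
    unfolding R[symmetric] by (simp only: mult.assoc)
  finally have v': "vec (Suc m) c = r *\<^sub>R ((g * ?R) * gen (Suc m) * (?R' * h))" .
  have "g * ?R * (?R' * h) = g * (?R * ?R') * h"
    by (simp only: mult.assoc)
  then have inv: "g * ?R * (?R' * h) = 1"
    using step gh(3) by (simp add: rot_inverse)
  have "(\<Sum>k=1..Suc m. (c k)\<^sup>2) = r\<^sup>2 * ((cos t)\<^sup>2 + (sin t)\<^sup>2)"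
    using \<rho> unfolding distrib_left by (simp add: rt power_mult_distrib)
  then have sq: "r\<^sup>2 = (\<Sum>k=1..Suc m. (c k)\<^sup>2)"
    by simp
  have mem: "g * ?R \<in> rotors (Suc m)" "?R' * h \<in> rotors (Suc m)"
    using gh step by (auto intro!: rotors_mult rot_rotors intro: rotors_mono)
  show ?case
    using v' inv sq mem by blast
qed

text \<open>Moving e_m to the right past \<open>h\<close> turns \<open>h\<close> into another
  product of rotors; the remaining scalar is 1 or -1, and the sign is absorbed by
  \<open>rotors_uminus\<close>.\<close>

lemma unit_vec_rotor_gen:
  assumes "2 \<le> m" "(\<Sum>k=1..m. (c k)\<^sup>2) = 1"
  shows "\<exists>y\<in>rotors m. vec m c = y * gen m"
proof -
  obtain \<rho> g h where gh: "g \<in> rotors m" "h \<in> rotors m" "\<rho>\<^sup>2 = 1" "vec m c = \<rho> *\<^sub>R (g * gen m * h)"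
    using vec_conjugate[of m c] assms by auto
  obtain h' where h': "h' \<in> rotors m" "gen m * h = h' * gen m"
    using gen_normalizes_rotors[OF gh(2)] by blast
  have "vec m c = \<rho> *\<^sub>R (g * h') * gen m"
    using gh(4) h'(2) by (simp add: mult.assoc)
  moreover have "\<rho> = 1 \<or> \<rho> = -1"
    using gh(3) by (simp add: power2_eq_1_iff)
  then have "\<rho> *\<^sub>R (g * h') \<in> rotors m"
    using rotors_mult[OF gh(1) h'(1)] rotors_uminus[OF assms(1)] by auto
  ultimately show ?thesis by blast
qed

text \<open>Left multiplication by a unit vector exchanges \<open>rotors m\<close> with its coset by
  e_m. These are the even and odd cases in the induction over a list of unit vectors.\<close>

lemma unit_vec_mult:
  assumes "2 \<le> m" "(\<Sum>k=1..m. (c k)\<^sup>2) = 1" "x \<in> rotors m"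
  shows "\<exists>y\<in>rotors m. vec m c * x = y * gen m" "vec m c * (x * gen m) \<in> rotors m"
proof -
  obtain y where y: "y \<in> rotors m" "vec m c = y * gen m"
    using unit_vec_rotor_gen assms by blast
  obtain x' where x': "x' \<in> rotors m" "gen m * x = x' * gen m"
    using gen_normalizes_rotors[OF assms(3)] by blast
  have 1: "vec m c * x = (y * x') * gen m"
    using y(2) x'(2) by (simp add: mult.assoc)
  then show "\<exists>y\<in>rotors m. vec m c * x = y * gen m"
    using rotors_mult[OF y(1) x'(1)] by blast
  have "vec m c * (x * gen m) = - (y * x')"
    using 1 gen_square[of m] assms(1) by (simp add: mult.assoc[symmetric]) (simp add: mult.assoc)
  then show "vec m c * (x * gen m) \<in> rotors m"
    using rotors_uminus[OF assms(1)] rotors_mult[OF y(1) x'(1)] by simp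
qed

section \<open>Products of unit vectors and their parity\<close>

definition vec_prod :: "nat \<Rightarrow> (nat \<Rightarrow> real) list \<Rightarrow> cliff" where
  "vec_prod m vs = foldr (*) (map (vec m) vs) 1"

lemma vec_prod_lower: "vec_prod m vs \<in> lower m"
  by (induction vs) (auto simp: vec_prod_def vec_lower)

lemma coef_vec_prod: "coef (vec_prod m vs) = foldr (cl_mult m) (map (cl_vec m) vs) cl_one"
proof (induction vs)
  case (Cons c vs)
  have "vec_prod m (c # vs) = vec m c * vec_prod m vs"
    by (simp add: vec_prod_def)
  then show ?case
    using Cons by (simp add: coef_mult_cl_mult[OF vec_lower vec_prod_lower] coef_vec)
qed (simp add: vec_prod_def coef_one)

lemma vec_prod_rotors:
  assumes "2 \<le> m" "\<forall>c\<in>set vs. (\<Sum>k=1..m. (c k)\<^sup>2) = 1"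
  shows "if even (length vs) then vec_prod m vs \<in> rotors m else \<exists>y\<in>rotors m. vec_prod m vs = y * gen m"
  using assms(2)
proof (induction vs)
  case Nil
  then show ?case by (simp add: vec_prod_def rotors.one)
next
  case (Cons c vs)
  have "vec_prod m (c # vs) = vec m c * vec_prod m vs"
    by (simp add: vec_prod_def)
  then show ?case
    using Cons unit_vec_mult[OF assms(1), of c] by (auto split: if_splits)
qed

lemma rotors_vec_prod:
  assumes "x \<in> rotors m"
  shows "\<exists>vs. even (length vs) \<and> (\<forall>c\<in>set vs. (\<Sum>k=1..m. (c k)\<^sup>2) = 1) \<and> x = vec_prod m vs"
  using assms
proof (induction rule: rotors.induct)
  case one
  show ?case by (rule exI[of _ "[]"]) (simp add: vec_prod_def)
next
  case (step x i a)
  then obtain vs where vs: "even (length vs)" "\<forall>c\<in>set vs. (\<Sum>k=1..m. (c k)\<^sup>2) = 1" "x = vec_prod m vs"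
    by blast
  \<comment> \<open>\<open>u\<close> and \<open>v\<close> are the coordinates of e_i and of - cos a
    e_i + sin a e_(i+1). Since e_i squares to -1, the product of these unit vectors is
    \<open>rot i a\<close>.\<close>
  define u :: "nat \<Rightarrow> real" where "u = (\<lambda>k. if k = i then 1 else 0)"
  define v where "v = (\<lambda>k. if k = i then - cos a else if k = Suc i then sin a else 0)"
  have if1: "(if Q then p else if Q' then q else (0::'b::real_vector)) = (if Q then p else 0) + (if Q' then q else 0)"
    if "\<not> (Q \<and> Q')" for Q Q' and p q
    using that by simp
  have ii: "i \<in> {1..m}" "Suc i \<in> {1..m}"
    using step by auto
  have u: "vec m u = gen i"
    using ii by (simp add: vec_def u_def if_distrib[of "\<lambda>x. x *\<^sub>R _"] cong: if_cong)
  have u1: "(\<Sum>k=1..m. (u k)\<^sup>2) = 1"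
    using ii by (simp add: u_def if_distrib[of "\<lambda>x. x\<^sup>2"] cong: if_cong)
  have "vec m v = (\<Sum>k=1..m. (if k = i then - cos a *\<^sub>R gen i else 0) + (if k = Suc i then sin a *\<^sub>R gen (Suc i) else 0))"
    unfolding vec_def v_def by (intro sum.cong) auto
  then have v: "vec m v = - cos a *\<^sub>R gen i + sin a *\<^sub>R gen (Suc i)"
    using ii by (simp add: sum.distrib)
  have "(\<Sum>k=1..m. (v k)\<^sup>2) = (\<Sum>k=1..m. (if k = i then (cos a)\<^sup>2 else 0) + (if k = Suc i then (sin a)\<^sup>2 else 0))"
    unfolding v_def by (intro sum.cong) auto
  then have v1: "(\<Sum>k=1..m. (v k)\<^sup>2) = 1"
    using ii by (simp add: sum.distrib)
  have "vec m u * vec m v = rot i a"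
    unfolding u v rot_def biv_def using step by (simp add: algebra_simps gen_square)
  then have "rot i a * x = vec_prod m (u # v # vs)"
    using vs(3) by (simp add: vec_prod_def flip: mult.assoc)
  then show ?case
    using vs u1 v1 by (intro exI[of _ "u # v # vs"]) auto
qed

lemma Spin_rotors:
  assumes "2 \<le> m"
  shows "Spin m = coef ` rotors m"
proof
  show "Spin m \<subseteq> coef ` rotors m"
    unfolding Spin_def coef_vec_prod[symmetric] using vec_prod_rotors[OF assms] by force
  show "coef ` rotors m \<subseteq> Spin m"
    unfolding Spin_def coef_vec_prod[symmetric] using rotors_vec_prod by fastforce
qed

lemma coef_rotors_mult: "x \<in> rotors m \<Longrightarrow> y \<in> rotors m \<Longrightarrow> cl_mult m (coef x) (coef y) = coef (x * y)"
  by (simp add: coef_mult_cl_mult[OF rotors_lower rotors_lower])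

lemma spin_grp_rotors:
  assumes "2 \<le> m"
  shows "carrier (spin_grp m) = coef ` rotors m"
  using Spin_rotors[OF assms] by (simp add: spin_grp_def)

lemma mult_spin_grp: "monoid.mult (spin_grp m) = cl_mult m"
  by (simp add: spin_grp_def)

lemma one_spin_grp: "one (spin_grp m) = coef 1"
  by (simp add: spin_grp_def coef_one)

lemma group_spin_grp:
  assumes "2 \<le> m"
  shows "group (spin_grp m)"
proof (rule groupI, unfold mult_spin_grp one_spin_grp spin_grp_rotors[OF assms])
  fix x assume "x \<in> coef ` rotors m"
  then show "\<exists>y\<in>coef ` rotors m. cl_mult m y x = coef 1"
    using rotors_inverse coef_rotors_mult by fastforce
qed (auto simp: coef_rotors_mult rotors_mult mult.assoc rotors.one)

section \<open>Explicit forms of Spin(2), Spin(3) and the embeddings\<close>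

lemma rotors_two: "x \<in> rotors 2 \<Longrightarrow> \<exists>a. x = rot 1 a"
proof (induction rule: rotors.induct)
  case one
  show ?case by (rule exI[of _ 0]) simp
next
  case (step x i a)
  then obtain b where "x = rot 1 b" "i = 1" by auto
  then show ?case
    using rot_mult[of 1 a b] by auto
qed

lemma Spin_two: "Spin 2 = range (\<lambda>a. coef (rot 1 a))"
  unfolding Spin_rotors[OF order_refl] using rotors_two rot_rotors[of 1 2] by fastforce

text \<open>Provides the coordinates in which the embeddings of Spin(3) are computed.\<close>

lemma rotors_three_quat: "x \<in> rotors 3 \<Longrightarrow> \<exists>p q r s. x = quat 1 p q r s"
proof (induction rule: rotors.induct)
  case one
  have "1 = quat 1 1 0 0 0" by (simp add: quat_def)
  then show ?case by blast
next
  case (step x i a)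
  then consider "i = 1" | "i = Suc 1" by fastforce
  then have "\<exists>p q r s. rot i a = quat 1 p q r s"
    using rot_quat by cases metis+
  then show ?case
    using step.IH quat_mult[of 1] by (metis order_refl)
qed

text \<open>\<open>emb\<close> acts on bare coefficient functions, so its linearity is phrased
  through equations between such functions. Embeddings can then be computed blade by blade.\<close>

lemma emb_add: "emb L (coef x) = coef x' \<Longrightarrow> emb L (coef y) = coef y' \<Longrightarrow> emb L (coef (x + y)) = coef (x' + y')"
proof
  fix T assume "emb L (coef x) = coef x'" "emb L (coef y) = coef y'"
  then have "coef (x' + y') T = emb L (coef x) T + emb L (coef y) T"
    by simp
  also have "\<dots> = emb L (coef (x + y)) T"
    unfolding emb_def sum.distrib[symmetric] by (intro sum.cong) auto
  finally show "emb L (coef (x + y)) T = coef (x' + y') T" ..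
qed

lemma emb_scaleR: "emb L (coef x) = coef x' \<Longrightarrow> emb L (coef (r *\<^sub>R x)) = coef (r *\<^sub>R x')"
proof
  fix T assume "emb L (coef x) = coef x'"
  then have "coef (r *\<^sub>R x') T = r * emb L (coef x) T"
    by simp
  also have "\<dots> = emb L (coef (r *\<^sub>R x)) T"
    unfolding emb_def sum_distrib_left by (intro sum.cong) auto
  finally show "emb L (coef (r *\<^sub>R x)) T = coef (r *\<^sub>R x') T" ..
qed

lemma emb_blade:
  assumes "L \<subseteq> {1..n}" "S \<subseteq> {1..card L}"
  shows "emb L (coef (blade S)) = coef (blade ((\<lambda>k. sorted_list_of_set L ! (k - 1)) ` S))" (is "_ = coef (blade (?f ` S))")
proof
  fix T
  have fin: "finite L" using assms(1) by (rule finite_subset) simp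
  have "?f ` S \<subseteq> L"
  proof
    fix t assume "t \<in> ?f ` S"
    then obtain k where k: "k \<in> S" "t = ?f k" by blast
    have "k \<in> {1..card L}"
      using k(1) assms(2) by blast
    then have "k - 1 < length (sorted_list_of_set L)"
      by auto
    then show "t \<in> L"
      unfolding k(2) using nth_mem set_sorted_list_of_set[OF fin] by blast
  qed
  then have sub: "?f ` S \<subseteq> {1..n}" using assms(1) by blast
  have "emb L (coef (blade S)) T = (\<Sum>S'\<in>Pow {1..card L}. if S' = S then (if ?f ` S = T then 1 else 0) else 0)"
    unfolding emb_def coef_blade[OF assms(2)] by (intro sum.cong) auto
  also have "\<dots> = coef (blade (?f ` S)) T"
    unfolding coef_blade[OF sub] using assms(2) by auto
  finally show "emb L (coef (blade S)) T = coef (blade (?f ` S)) T" .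
qed

lemma emb_one: "L \<subseteq> {1..n} \<Longrightarrow> emb L (coef 1) = coef 1"
  using emb_blade[of L n "{}"] by (simp add: blade_empty)

lemma emb_two_rot:
  assumes "1 \<le> i"
  shows "emb {i, i + 1} (coef (rot 1 a)) = coef (rot i a)"
proof -
  have L: "{i, i + 1} \<subseteq> {1..Suc i}" using assms by auto
  have "emb {i, i + 1} (coef (blade {1, Suc 1})) = coef (blade {i, Suc i})"
    by (subst emb_blade[OF L]) auto
  then show ?thesis
    unfolding rot_def biv_blade[OF assms] biv_blade[OF order_refl]
    by (intro emb_add emb_scaleR emb_one[OF L])
qed

lemma emb_three_quat:
  assumes "1 \<le> i"
  shows "emb {i, i + 1, i + 2} (coef (quat 1 p q r s)) = coef (quat i p q r s)"
proof -
  have L: "{i, i + 1, i + 2} \<subseteq> {1..i + 2}" using assms by auto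
  have c: "card {i, i + 1, i + 2} = 3" by simp
  have 1: "emb {i, i + 1, i + 2} (coef (blade {1, Suc 1})) = coef (blade {i, Suc i})"
    by (subst emb_blade[OF L]) auto
  have 2: "emb {i, i + 1, i + 2} (coef (blade {Suc 1, Suc (Suc 1)})) = coef (blade {Suc i, Suc (Suc i)})"
    by (subst emb_blade[OF L]) (auto simp: numeral_2_eq_2)
  have 3: "emb {i, i + 1, i + 2} (coef (blade {1, Suc (Suc 1)})) = coef (blade {i, Suc (Suc i)})"
    by (subst emb_blade[OF L]) (auto simp: numeral_2_eq_2)
  \<comment> \<open>\<open>emb\<close> has been evaluated on blades, so the third quaternion unit is
    rewritten as one: it is minus the blade of e_j and e_(j+2), because the middle generator squares
    to -1.\<close>
  have q: "quat j p q r s = p *\<^sub>R 1 + q *\<^sub>R blade {j, Suc j} + r *\<^sub>R blade {Suc j, Suc (Suc j)}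
      + (-s) *\<^sub>R blade {j, Suc (Suc j)}" if "1 \<le> j" for j
    unfolding quat_def biv_mult_biv_blade[OF that]
    unfolding biv_blade[OF that] using biv_blade[of "Suc j"] by simp
  show ?thesis
    unfolding q[OF assms] q[OF order_refl]
    by (intro emb_add emb_scaleR emb_one[OF L] 1 2 3)
qed

section \<open>Groups generated by a braided chain of subgroups\<close>

lemma (in group) additive_range_subgroup:
  fixes f :: "'c::ab_group_add \<Rightarrow> 'a"
  assumes "\<And>a. f a \<in> carrier G" and add: "\<And>a b. f (a + b) = f a \<otimes> f b"
  shows "subgroup (range f) G"
proof (rule subgroupI)
  have "f 0 \<otimes> f 0 = f 0"
    using add[of 0 0] by simp
  then have 0: "f 0 = \<one>"
    using assms(1) by (metis l_cancel_one)
  fix x assume "x \<in> range f"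
  then obtain a where a: "x = f a" by blast
  have "f (- a) \<otimes> f a = \<one>"
    using add[of "- a" a] 0 by simp
  then have "inv x = f (- a)"
    unfolding a by (intro inv_equality) (auto intro: assms(1))
  then show "inv x \<in> range f" by blast
next
  fix x y assume "x \<in> range f" "y \<in> range f"
  then obtain a b where "x = f a" "y = f b" by blast
  then show "x \<otimes> y \<in> range f"
    by (simp flip: add)
qed (use assms(1) in auto)

locale braided_subgroups = group G for G (structure) +
  fixes S :: "nat \<Rightarrow> 'a set" and N :: nat
  assumes S_subgroup: "1 \<le> i \<Longrightarrow> i \<le> N \<Longrightarrow> subgroup (S i) G"
    and S_commute: "1 \<le> i \<Longrightarrow> Suc i < j \<Longrightarrow> j \<le> N \<Longrightarrow> x \<in> S i \<Longrightarrow> y \<in> S j \<Longrightarrow> x \<otimes> y = y \<otimes> x"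
    and S_braid: "1 \<le> i \<Longrightarrow> Suc i \<le> N \<Longrightarrow> x \<in> S (Suc i) \<Longrightarrow> y \<in> S i \<Longrightarrow> z \<in> S (Suc i) \<Longrightarrow>
      \<exists>a\<in>S i. \<exists>b\<in>S (Suc i). \<exists>c\<in>S i. x \<otimes> y \<otimes> z = a \<otimes> b \<otimes> c"
begin

text \<open>The double coset form, instead of a generated subgroup, gives every element a
  factorisation with a single factor from \<open>S (Suc k)\<close>, along which one can descend.
  Closure under products is then a theorem, \<open>chain_subgroup\<close>.\<close>

primrec chain :: "nat \<Rightarrow> 'a set" where
  "chain 0 = {\<one>}"
| "chain (Suc k) = {a \<otimes> x \<otimes> b | a x b. a \<in> chain k \<and> x \<in> S (Suc k) \<and> b \<in> chain k}"

lemmas chain_Suc = chain.simps(2)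

declare chain_Suc [simp del]

lemma S_carrier: "1 \<le> i \<Longrightarrow> i \<le> N \<Longrightarrow> x \<in> S i \<Longrightarrow> x \<in> carrier G"
  by (rule subgroup.mem_carrier[OF S_subgroup])

lemma chain_carrier: "k \<le> N \<Longrightarrow> a \<in> chain k \<Longrightarrow> a \<in> carrier G"
proof (induction k arbitrary: a)
  case (Suc k)
  then show ?case
    using S_carrier[of "Suc k"] by (auto simp: chain_Suc)
qed simp

lemma one_chain: "k \<le> N \<Longrightarrow> \<one> \<in> chain k"
proof (induction k)
  case (Suc k)
  then have "\<one> \<in> chain k" "\<one> \<in> S (Suc k)"
    using subgroup.one_closed[OF S_subgroup] by auto
  moreover have "\<one> = \<one> \<otimes> \<one> \<otimes> \<one>" by simp
  ultimately show ?case
    unfolding chain_Suc by blast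
qed simp

lemma S_subset_chain:
  assumes "Suc k \<le> N"
  shows "S (Suc k) \<subseteq> chain (Suc k)"
proof
  fix x assume x: "x \<in> S (Suc k)"
  then have "x = \<one> \<otimes> x \<otimes> \<one>"
    using S_carrier[of "Suc k"] assms by simp
  then show "x \<in> chain (Suc k)"
    using x one_chain[of k] assms unfolding chain_Suc by fastforce
qed

lemma chain_Suc_mono:
  assumes "Suc k \<le> N"
  shows "chain k \<subseteq> chain (Suc k)"
proof
  fix a assume a: "a \<in> chain k"
  then have "a = a \<otimes> \<one> \<otimes> \<one>"
    using chain_carrier[of k] assms by simp
  then show "a \<in> chain (Suc k)"
    using a one_chain[of k] subgroup.one_closed[OF S_subgroup, of "Suc k"] assms
    unfolding chain_Suc by fastforce
qed

text \<open>\<open>chain k\<close> is built from \<open>S 1\<close>, ..., \<open>S k\<close>, all of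
  which have index distance at least two from \<open>j\<close>.\<close>

lemma chain_commute:
  assumes "Suc k < j" "j \<le> N" "x \<in> S j" "a \<in> chain k"
  shows "a \<otimes> x = x \<otimes> a"
  using assms(1,4)
proof (induction k arbitrary: a)
  case 0
  then show ?case
    using S_carrier[of j] assms by simp
next
  case (Suc k)
  then obtain p y q where a: "a = p \<otimes> y \<otimes> q" "p \<in> chain k" "y \<in> S (Suc k)" "q \<in> chain k"
    unfolding chain_Suc by blast
  have c: "p \<in> carrier G" "q \<in> carrier G" "y \<in> carrier G" "x \<in> carrier G"
    using a chain_carrier[of k] S_carrier[of "Suc k"] S_carrier[of j] Suc.prems assms by auto
  have px: "p \<otimes> x = x \<otimes> p" and qx: "q \<otimes> x = x \<otimes> q"
    using Suc a by auto
  have yx: "y \<otimes> x = x \<otimes> y"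
    using S_commute[of "Suc k" j y x] Suc.prems a assms by auto
  have "a \<otimes> x = p \<otimes> (y \<otimes> (q \<otimes> x))"
    unfolding a(1) using c by (simp add: m_assoc)
  also have "\<dots> = p \<otimes> ((y \<otimes> x) \<otimes> q)"
    unfolding qx using c by (simp add: m_assoc)
  also have "\<dots> = (p \<otimes> x) \<otimes> (y \<otimes> q)"
    unfolding yx using c by (simp add: m_assoc)
  also have "\<dots> = x \<otimes> a"
    unfolding px a(1) using c by (simp add: m_assoc)
  finally show ?case .
qed

text \<open>Write \<open>w = p \<otimes> y \<otimes> q\<close> with \<open>p\<close> and
  \<open>q\<close> from one level lower. These commute with \<open>S (Suc k)\<close>, so the braid
  inclusion applies to \<open>x \<otimes> y \<otimes> x'\<close>, and the outer factors are absorbed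
  into \<open>chain k\<close>.\<close>

lemma sandwich_chain:
  assumes "Suc k \<le> N" "subgroup (chain k) G" "x \<in> S (Suc k)" "w \<in> chain k" "x' \<in> S (Suc k)"
  shows "x \<otimes> w \<otimes> x' \<in> chain (Suc k)"
proof (cases k)
  case 0
  then have "x \<otimes> w \<otimes> x' = x \<otimes> x'"
    using assms S_carrier[of "Suc k"] by simp
  also have "\<dots> \<in> S (Suc k)"
    using assms S_subgroup[of "Suc k"] by (simp add: subgroup.m_closed)
  finally show ?thesis
    using S_subset_chain assms(1) by blast
next
  case (Suc k')
  then obtain p y q where w: "w = p \<otimes> y \<otimes> q" "p \<in> chain k'" "y \<in> S k" "q \<in> chain k'"
    using assms(4) unfolding Suc chain_Suc by blast
  have c: "p \<in> carrier G" "q \<in> carrier G" "y \<in> carrier G" "x \<in> carrier G" "x' \<in> carrier G"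
    using w chain_carrier[of k'] S_carrier[of k] S_carrier[of "Suc k"] assms Suc by auto
  have px: "x \<otimes> p = p \<otimes> x" and qx: "q \<otimes> x' = x' \<otimes> q"
    using chain_commute[of k' "Suc k" x p] chain_commute[of k' "Suc k" x' q] w(2,4) assms(1,3,5) Suc
    by simp_all
  obtain a b d where abd: "a \<in> S k" "b \<in> S (Suc k)" "d \<in> S k" "x \<otimes> y \<otimes> x' = a \<otimes> b \<otimes> d"
    using S_braid[of k x y x'] assms w Suc by auto
  have c': "a \<in> carrier G" "b \<in> carrier G" "d \<in> carrier G"
    using abd S_carrier[of k] S_carrier[of "Suc k"] assms Suc by auto
  have "x \<otimes> w \<otimes> x' = (x \<otimes> p) \<otimes> (y \<otimes> (q \<otimes> x'))"
    unfolding w(1) using c by (simp add: m_assoc)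
  also have "\<dots> = p \<otimes> (x \<otimes> y \<otimes> x') \<otimes> q"
    unfolding px qx using c by (simp add: m_assoc)
  also have "\<dots> = (p \<otimes> a) \<otimes> b \<otimes> (d \<otimes> q)"
    unfolding abd(4) using c c' by (simp add: m_assoc)
  finally have eq: "x \<otimes> w \<otimes> x' = (p \<otimes> a) \<otimes> b \<otimes> (d \<otimes> q)" .
  have "chain k' \<subseteq> chain k" "S k \<subseteq> chain k"
    using chain_Suc_mono[of k'] S_subset_chain[of k'] assms(1) unfolding Suc by auto
  then have "p \<otimes> a \<in> chain k" "d \<otimes> q \<in> chain k"
    using w abd subgroup.m_closed[OF assms(2)] by auto
  then show ?thesis
    unfolding eq chain.simps using abd(2) by blast
qed

lemma chain_subgroup: "k \<le> N \<Longrightarrow> subgroup (chain k) G"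
proof (induction k)
  case 0
  then show ?case
    using triv_subgroup by simp
next
  case (Suc k)
  then have IH: "subgroup (chain k) G" and k: "Suc k \<le> N" by auto
  have cc: "\<And>a. a \<in> chain k \<Longrightarrow> a \<in> carrier G" "\<And>x. x \<in> S (Suc k) \<Longrightarrow> x \<in> carrier G"
    using chain_carrier[of k] S_carrier[of "Suc k"] k by auto
  show ?case
  proof (rule subgroupI)
    show "chain (Suc k) \<subseteq> carrier G"
      using chain_carrier[of "Suc k"] k by blast
    show "chain (Suc k) \<noteq> {}"
      using one_chain[of "Suc k"] k by blast
    fix d assume "d \<in> chain (Suc k)"
    then obtain a x b where d: "d = a \<otimes> x \<otimes> b" "a \<in> chain k" "x \<in> S (Suc k)" "b \<in> chain k"
      unfolding chain_Suc by blast
    have "inv d = inv b \<otimes> inv x \<otimes> inv a"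
      using d cc by (simp add: inv_mult_group m_assoc)
    then show "inv d \<in> chain (Suc k)"
      unfolding chain_Suc
      using d subgroup.m_inv_closed[OF IH] subgroup.m_inv_closed[OF S_subgroup, of "Suc k"] k by fastforce
    fix d' assume "d' \<in> chain (Suc k)"
    then obtain a' x' b' where d': "d' = a' \<otimes> x' \<otimes> b'" "a' \<in> chain k" "x' \<in> S (Suc k)" "b' \<in> chain k"
      unfolding chain_Suc by blast
    have w: "b \<otimes> a' \<in> chain k"
      using d d' subgroup.m_closed[OF IH] by blast
    obtain p y q where p: "x \<otimes> (b \<otimes> a') \<otimes> x' = p \<otimes> y \<otimes> q" "p \<in> chain k" "y \<in> S (Suc k)" "q \<in> chain k"
      using sandwich_chain[OF k IH d(3) w d'(3)] unfolding chain_Suc by blast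
    have "d \<otimes> d' = a \<otimes> (x \<otimes> (b \<otimes> a') \<otimes> x') \<otimes> b'"
      unfolding d(1) d'(1) using d d' cc by (simp add: m_assoc)
    also have "\<dots> = (a \<otimes> p) \<otimes> y \<otimes> (q \<otimes> b')"
      unfolding p(1) using p d d' cc by (simp add: m_assoc)
    finally show "d \<otimes> d' \<in> chain (Suc k)"
      unfolding chain_Suc using p d d' subgroup.m_closed[OF IH] by blast
  qed
qed

lemma chain_mono: "i \<le> k \<Longrightarrow> k \<le> N \<Longrightarrow> chain i \<subseteq> chain k"
proof (induction rule: dec_induct)
  case (step m)
  then show ?case
    using chain_Suc_mono[of m] subset_trans[of "chain i" "chain m"] by simp
qed simp

lemma S_subset_chain_N:
  assumes "1 \<le> i" "i \<le> N"
  shows "S i \<subseteq> chain N"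
proof -
  obtain k where i: "i = Suc k"
    using Suc_le_D[of 0 i] assms(1) by auto
  have "S (Suc k) \<subseteq> chain (Suc k)" "chain (Suc k) \<subseteq> chain N"
    using S_subset_chain[of k] chain_mono[of "Suc k" N] assms(2) unfolding i by (simp_all only: order_refl)
  then show ?thesis
    unfolding i by (rule subset_trans)
qed

text \<open>If \<open>a \<otimes> x \<otimes> b\<close> is in the kernel, then
  \<open>\<pi> x\<close> is the image of \<open>inv a \<otimes> inv b\<close>, which lies in
  \<open>chain k\<close>. By \<open>descend\<close>, \<open>x\<close> and with it the whole product
  drop one level, until \<open>base\<close> applies in \<open>S 1\<close>.\<close>

lemma hom_inj_on_chain:
  assumes "group K" "\<pi> \<in> hom G K"
    and base: "\<And>x. 1 \<le> N \<Longrightarrow> x \<in> S 1 \<Longrightarrow> \<pi> x = \<one>\<^bsub>K\<^esub> \<Longrightarrow> x = \<one>"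
    and descend: "\<And>k x. 1 \<le> k \<Longrightarrow> Suc k \<le> N \<Longrightarrow> x \<in> S (Suc k) \<Longrightarrow> \<pi> x \<in> \<pi> ` chain k \<Longrightarrow> x \<in> S k"
    and "k \<le> N" "d \<in> chain k" "\<pi> d = \<one>\<^bsub>K\<^esub>"
  shows "d = \<one>"
  using assms(5-7)
proof (induction k arbitrary: d)
  case 0
  then show ?case by simp
next
  case (Suc k)
  have hom: "group_hom G K \<pi>"
    using assms(1,2) by (intro group_hom.intro group_hom_axioms.intro) (rule is_group)
  obtain a x b where d: "d = a \<otimes> x \<otimes> b" "a \<in> chain k" "x \<in> S (Suc k)" "b \<in> chain k"
    using Suc.prems(2) unfolding chain_Suc by blast
  have k: "Suc k \<le> N" by fact
  have c: "a \<in> carrier G" "x \<in> carrier G" "b \<in> carrier G"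
    using d k chain_carrier[of k] S_carrier[of "Suc k"] by auto
  have sub: "subgroup (chain k) G"
    using chain_subgroup k by simp
  show ?case
  proof (cases k)
    case 0
    \<comment> \<open>\<open>chain 0\<close> is trivial, so the product is its middle factor from
      \<open>S 1\<close>.\<close>
    then have x: "x = d" using d c by simp
    show ?thesis
      using base[of d] Suc.prems(1,3) d(3) 0 unfolding x by simp
  next
    case (Suc k')
    have "x = inv a \<otimes> d \<otimes> inv b"
      unfolding d(1) using c by (simp add: m_assoc inv_solve_left)
    moreover have "d \<in> carrier G" using d c by simp
    ultimately have "\<pi> x = \<pi> (inv a) \<otimes>\<^bsub>K\<^esub> \<one>\<^bsub>K\<^esub> \<otimes>\<^bsub>K\<^esub> \<pi> (inv b)"
      using c by (simp only: hom_mult[OF assms(2)] m_closed inv_closed Suc.prems(3))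
    also have "\<dots> = \<pi> (inv a \<otimes> inv b)"
      using c group_hom.hom_closed[OF hom] by (simp add: hom_mult[OF assms(2)] monoid.r_one group.is_monoid[OF assms(1)])
    finally have "\<pi> x \<in> \<pi> ` chain k"
      using d subgroup.m_closed[OF sub] subgroup.m_inv_closed[OF sub] by blast
    then have "x \<in> S k"
      using descend[of k x] Suc k d by simp
    then have "x \<in> chain k"
      using S_subset_chain[of k'] Suc k by auto
    then have "d \<in> chain k"
      unfolding d(1) using d subgroup.m_closed[OF sub] by blast
    then show ?thesis
      using Suc.IH Suc.prems by simp
  qed
qed

end

section \<open>Spin(n) as an enveloping group\<close>

lemma rot_two_quat: "rot 2 a = quat 1 (cos a) 0 (sin a) 0"
  using rot_quat(2)[of 1 a] by (simp add: numeral_2_eq_2)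

lemma emb_first_two: "emb {1, 2} (coef (rot 1 a)) = coef (rot 1 a)"
  using emb_two_rot[of 1 a] by (simp add: numeral_2_eq_2)

lemma emb_last_two: "emb {2, 3} (coef (rot 1 a)) = coef (rot 2 a)"
  using emb_two_rot[of 2 a] by (simp add: numeral_3_eq_3)

lemma tauA_quat: "1 \<le> i \<Longrightarrow> tauA i (coef (quat 1 p q r s)) = coef (quat i p q r s)"
  unfolding tauA_def by (rule emb_three_quat)

lemma tauA_rot:
  assumes "1 \<le> i"
  shows "tauA i (coef (rot 1 a)) = coef (rot i a)" "tauA i (coef (rot 2 a)) = coef (rot (Suc i) a)"
  using tauA_quat[OF assms] rot_quat(1)[of 1 a] rot_quat(1)[of i a] rot_quat(2)[of i a] rot_two_quat[of a]
  by metis+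

text \<open>In quaternion coordinates \<open>tauA i\<close> changes only the index of
  \<open>quat\<close>, and the product formula is the same at every index.\<close>

lemma tauA_mult:
  assumes "1 \<le> i" "x \<in> rotors 3" "y \<in> rotors 3" "tauA i (coef x) = coef x'" "tauA i (coef y) = coef y'"
  shows "tauA i (coef (x * y)) = coef (x' * y')"
proof -
  obtain p q r s where x: "x = quat 1 p q r s"
    using rotors_three_quat assms by blast
  obtain p' q' r' s' where y: "y = quat 1 p' q' r' s'"
    using rotors_three_quat assms by blast
  have xy': "x' = quat i p q r s" "y' = quat i p' q' r' s'"
    using assms(4,5) unfolding x y tauA_quat[OF assms(1)] coef_inject by simp_all
  then show ?thesis
    by (simp only: x y xy' quat_mult[OF order_refl] quat_mult[OF assms(1)] tauA_quat[OF assms(1)])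
qed

lemma rotors_three_cases:
  assumes "1 \<le> i" "i < (3::nat)"
  obtains "i = 1" | "i = 2"
  using assms by fastforce

lemma tauA_rotors:
  assumes "1 \<le> i" "i + 2 \<le> n" "x \<in> rotors 3"
  shows "\<exists>x'\<in>rotors n. tauA i (coef x) = coef x'"
  using assms(3)
proof (induction rule: rotors.induct)
  case one
  show ?case
    using tauA_rot(1)[OF assms(1), of 0] by (intro bexI[of _ 1] rotors.one) simp
next
  case (step x j a)
  then obtain x' where x': "x' \<in> rotors n" "tauA i (coef x) = coef x'" by blast
  have j: "rot j a \<in> rotors 3"
    using step by (simp add: rot_rotors)
  have "\<exists>r\<in>rotors n. tauA i (coef (rot j a)) = coef r"
    using step(2,3)
  proof (cases rule: rotors_three_cases)
    case 1
    then show ?thesis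
      using tauA_rot(1)[OF assms(1)] rot_rotors[of i n] assms by auto
  next
    case 2
    then show ?thesis
      using tauA_rot(2)[OF assms(1)] rot_rotors[of "Suc i" n] assms by auto
  qed
  then show ?case
    using tauA_mult[OF assms(1) j step(1) _ x'(2)] rotors_mult x'(1) by blast
qed

lemma tauA_hom:
  assumes "1 \<le> i" "i + 2 \<le> n"
  shows "tauA i \<in> hom (spin_grp 3) (spin_grp n)"
proof (rule homI)
  fix x y assume "x \<in> carrier (spin_grp 3)" "y \<in> carrier (spin_grp 3)"
  then obtain u v where u: "x = coef u" "u \<in> rotors 3" and v: "y = coef v" "v \<in> rotors 3"
    by (auto simp: spin_grp_rotors)
  obtain u' where u': "u' \<in> rotors n" "tauA i x = coef u'"
    using tauA_rotors[OF assms u(2)] u(1) by blast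
  obtain v' where v': "v' \<in> rotors n" "tauA i y = coef v'"
    using tauA_rotors[OF assms v(2)] v(1) by blast
  show "tauA i x \<in> carrier (spin_grp n)"
    using u' assms by (simp add: spin_grp_rotors)
  show "tauA i (monoid.mult (spin_grp 3) x y) = monoid.mult (spin_grp n) (tauA i x) (tauA i y)"
    using tauA_mult[OF assms(1) u(2) v(2)] u v u' v' by (simp add: mult_spin_grp coef_rotors_mult)
qed

lemma tauB_rot:
  assumes "1 \<le> i" "i < n" "1 \<le> j" "j < n"
  shows "tauB n i j (coef (rot 1 a), coef (rot 1 b)) = coef (rot i a * rot j b)"
  unfolding tauB_def fst_conv snd_conv emb_two_rot[OF assms(1)] emb_two_rot[OF assms(3)]
  using assms by (simp add: coef_rotors_mult rot_rotors)

lemma spin22_carrier: "carrier spin22 = {(coef (rot 1 a), coef (rot 1 b)) | a b. True}"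
  by (auto simp: spin22_def DirProd_def spin_grp_def Spin_two)

lemma spin22_mult: "monoid.mult spin22 (coef (rot 1 a), coef (rot 1 b)) (coef (rot 1 c), coef (rot 1 d))
    = (coef (rot 1 (a + c)), coef (rot 1 (b + d)))"
  by (simp add: spin22_def DirProd_def mult_spin_grp coef_rotors_mult rot_rotors rot_mult)

lemma tauB_hom:
  assumes "1 \<le> i" "i + 1 < j" "j < n"
  shows "tauB n i j \<in> hom spin22 (spin_grp n)"
proof (rule homI)
  have n: "2 \<le> n" using assms by simp
  fix x assume "x \<in> carrier spin22"
  then obtain a b where x: "x = (coef (rot 1 a), coef (rot 1 b))"
    by (auto simp: spin22_carrier)
  show "tauB n i j x \<in> carrier (spin_grp n)"
    using assms tauB_rot[of i n j a b] unfolding x spin_grp_rotors[OF n]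
    by (simp add: rotors_mult rot_rotors)
  fix y assume "y \<in> carrier spin22"
  then obtain c d where y: "y = (coef (rot 1 c), coef (rot 1 d))"
    by (auto simp: spin22_carrier)
  have m: "rot i a * rot j b \<in> rotors n" "rot i c * rot j d \<in> rotors n"
    using assms by (simp_all add: rotors_mult rot_rotors)
  have "rot i (a + c) * rot j (b + d) = rot i a * (rot i c * rot j b) * rot j d"
    using assms by (simp add: mult.assoc flip: rot_mult)
  also have "rot i c * rot j b = rot j b * rot i c"
    using rot_commute[of i j] assms by simp
  finally have "rot i (a + c) * rot j (b + d) = (rot i a * rot j b) * (rot i c * rot j d)"
    by (simp only: mult.assoc)
  then show "tauB n i j (monoid.mult spin22 x y) = monoid.mult (spin_grp n) (tauB n i j x) (tauB n i j y)"
    using assms m tauB_rot[of i n j a b] tauB_rot[of i n j c d] tauB_rot[of i n j "a + c" "b + d"]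
    unfolding x y spin22_mult mult_spin_grp by (simp add: coef_rotors_mult)
qed

lemma cl_one_rot: "cl_one = coef (rot 1 0)"
  by (simp add: coef_one)

text \<open>The value does not depend on \<open>i\<close>, which is the compatibility condition of
  an enveloping group.\<close>

lemma vmap_tau:
  assumes "i \<in> {1..n-1}" "j \<in> {1..n-1}" "i \<noteq> j"
  shows "vmap tauA (tauB n) i j (coef (rot 1 a)) = coef (rot j a)"
proof -
  have n: "1 \<le> i" "i < n" "1 \<le> j" "j < n"
    using assms by auto
  consider "j = i + 1" | "i = j + 1" | "j \<noteq> i + 1" "i \<noteq> j + 1" by blast
  then show ?thesis
  proof cases
    case 1
    then show ?thesis
      using tauA_rot(2)[of i a] n unfolding vmap_def emb_last_two by simp
  next
    case 2
    then show ?thesis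
      using tauA_rot(1)[of j a] n unfolding vmap_def emb_first_two by simp
  next
    case 3
    then show ?thesis
      using tauB_rot[of i n j 0 a] tauB_rot[of j n i a 0] n unfolding vmap_def cl_one_rot by simp
  qed
qed

text \<open>For \<open>n \<ge> 3\<close> every vertex lies on an edge: vertex 1 is the first end of
  the first edge, any other vertex the second end of the edge before it. This yields generation of
  Spin(n) and, later, uniqueness.\<close>

lemma rot_generators:
  assumes "1 \<le> i" "i < n" "3 \<le> n"
  shows "\<exists>k x. 1 \<le> k \<and> k + 1 \<le> n - 1 \<and> x \<in> Spin 3 \<and> tauA k x = coef (rot i a)"
proof (cases "i = 1")
  case True
  then show ?thesis
    using assms tauA_rot(1)[of 1 a] rot_rotors[of 1 3 a]
    by (intro exI[of _ 1] exI[of _ "coef (rot 1 a)"]) (simp add: Spin_rotors)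
next
  case False
  then have "1 \<le> i - 1" "i - 1 + 1 \<le> n - 1" "Suc (i - 1) = i"
    using assms by auto
  then show ?thesis
    using tauA_rot(2)[of "i - 1" a] rot_rotors[of 2 3 a]
    by (intro exI[of _ "i - 1"] exI[of _ "coef (rot 2 a)"]) (simp add: Spin_rotors)
qed

lemma envelope_spin:
  assumes "3 \<le> n"
  shows "envelope n (spin_grp n) tauA (tauB n)"
proof -
  interpret group "spin_grp n"
    using assms by (intro group_spin_grp) simp
  let ?gens = "(\<Union>i\<in>{i. 1 \<le> i \<and> i + 1 \<le> n - 1}. tauA i ` Spin 3) \<union>
         (\<Union>(i, j)\<in>{(i, j). 1 \<le> i \<and> i + 1 < j \<and> j \<le> n - 1}. tauB n i j ` carrier spin22)"
  have homA: "tauA i \<in> hom (spin_grp 3) (spin_grp n)" if "1 \<le> i" "i + 1 \<le> n - 1" for i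
    using that by (intro tauA_hom) auto
  have homB: "tauB n i j \<in> hom spin22 (spin_grp n)" if "1 \<le> i" "i + 1 < j" "j \<le> n - 1" for i j
    using that by (intro tauB_hom) auto
  have car: "carrier (spin_grp 3) = Spin 3" by (simp add: spin_grp_def)
  have sub: "?gens \<subseteq> carrier (spin_grp n)"
    using homA homB unfolding hom_def Pi_def car by blast
  have n: "2 \<le> n" using assms by simp
  have "coef x \<in> generate (spin_grp n) ?gens" if "x \<in> rotors n" for x
    using that
  proof (induction rule: rotors.induct)
    case one
    then show ?case
      using generate.one[of "spin_grp n" ?gens] by (simp only: one_spin_grp)
  next
    case (step x i a)
    have "coef (rot i a) \<in> ?gens"
      using rot_generators[OF step(2,3) assms, of a] by (metis (mono_tags, lifting) UN_I UnI1 imageI mem_Collect_eq)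
    then have "monoid.mult (spin_grp n) (coef (rot i a)) (coef x) \<in> generate (spin_grp n) ?gens"
      by (intro generate.eng[OF generate.incl step.IH])
    then show ?case
      using step by (simp add: mult_spin_grp coef_rotors_mult rot_rotors)
  qed
  then have "carrier (spin_grp n) \<subseteq> generate (spin_grp n) ?gens"
    unfolding spin_grp_rotors[OF n] by blast
  moreover have "generate (spin_grp n) ?gens \<subseteq> carrier (spin_grp n)"
    by (rule generate_incl[OF sub])
  ultimately have gen: "carrier (spin_grp n) = generate (spin_grp n) ?gens" by blast
  have "\<forall>x\<in>Spin 2. vmap tauA (tauB n) i j x = vmap tauA (tauB n) k j x"
    if "i \<in> {1..n-1}" "j \<in> {1..n-1}" "k \<in> {1..n-1}" "i \<noteq> j" "j \<noteq> k" for i j k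
    using that vmap_tau unfolding Spin_two by auto
  then show ?thesis
    unfolding envelope_def using homA homB gen is_group by blast
qed

section \<open>Universality\<close>

lemma hom_coef_mult:
  assumes "f \<in> hom (spin_grp m) K" "2 \<le> m" "x \<in> rotors m" "y \<in> rotors m"
  shows "f (coef (x * y)) = f (coef x) \<otimes>\<^bsub>K\<^esub> f (coef y)"
proof -
  have "f (monoid.mult (spin_grp m) (coef x) (coef y)) = f (coef x) \<otimes>\<^bsub>K\<^esub> f (coef y)"
    by (rule hom_mult[OF assms(1)]) (use assms in \<open>auto simp: spin_grp_rotors\<close>)
  then show ?thesis
    using assms by (simp add: mult_spin_grp coef_rotors_mult)
qed

lemma hom_coef_closed:
  assumes "f \<in> hom (spin_grp m) K" "2 \<le> m" "x \<in> rotors m"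
  shows "f (coef x) \<in> carrier K"
  using hom_in_carrier[OF assms(1)] assms(2,3) by (auto simp: spin_grp_rotors)

lemma hom_spin_eq:
  assumes K: "group K" and m: "2 \<le> m" and f: "f \<in> hom (spin_grp m) K" and g: "g \<in> hom (spin_grp m) K"
    and eq: "\<And>i a. 1 \<le> i \<Longrightarrow> i < m \<Longrightarrow> f (coef (rot i a)) = g (coef (rot i a))"
    and x: "x \<in> Spin m"
  shows "f x = g x"
proof -
  have "f (coef x) = g (coef x)" if "x \<in> rotors m" for x
    using that
  proof (induction rule: rotors.induct)
    case one
    then show ?case
      using hom_one[OF f group_spin_grp[OF m] K] hom_one[OF g group_spin_grp[OF m] K]
      by (simp add: one_spin_grp)
  next
    case (step x i a)
    then show ?case
      using hom_coef_mult[OF f m rot_rotors] hom_coef_mult[OF g m rot_rotors] eq by simp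
  qed
  then show ?thesis
    using x Spin_rotors[OF m] by auto
qed

lemma rotors_three_rot: "rot 1 a \<in> rotors 3" "rot 2 a \<in> rotors 3"
  by (auto intro: rot_rotors)

section \<open>The one-parameter subgroups in an enveloping group\<close>

locale spin_envelope = group H for H (structure) +
  fixes n :: nat and tA :: "nat \<Rightarrow> mvec \<Rightarrow> 'a" and tB :: "nat \<Rightarrow> nat \<Rightarrow> mvec \<times> mvec \<Rightarrow> 'a"
  assumes n3: "3 \<le> n" and env: "envelope n H tA tB"
begin

lemma homA: "1 \<le> i \<Longrightarrow> i + 2 \<le> n \<Longrightarrow> tA i \<in> hom (spin_grp 3) H"
  using env unfolding envelope_def by auto

lemma homB: "1 \<le> i \<Longrightarrow> i + 1 < j \<Longrightarrow> j < n \<Longrightarrow> tB i j \<in> hom spin22 H"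
  using env unfolding envelope_def by auto

lemma compat:
  assumes "1 \<le> i" "i < n" "1 \<le> j" "j < n" "1 \<le> k" "k < n" "i \<noteq> j" "j \<noteq> k"
  shows "vmap tA tB i j (coef (rot 1 a)) = vmap tA tB k j (coef (rot 1 a))"
proof -
  have r: "i \<in> {1..n-1}" "j \<in> {1..n-1}" "k \<in> {1..n-1}"
    using assms by auto
  have s: "coef (rot 1 a) \<in> Spin 2"
    unfolding Spin_two by blast
  show ?thesis
  proof (cases "i = k")
    case False
    then show ?thesis
      using env r s assms(7,8) unfolding envelope_def by blast
  qed simp
qed

text \<open>The value at S(a) of the homomorphism attached to vertex \<open>i\<close>, read off one
  chosen edge at \<open>i\<close>. The lemmas below show that the other maps starting at
  \<open>i\<close> give the same value.\<close>

definition rotH :: "nat \<Rightarrow> real \<Rightarrow> 'a" where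
  "rotH i a = (if i = 1 then tA 1 (coef (rot 1 a)) else tA (i - 1) (coef (rot 2 a)))"

lemma tA_rot:
  assumes "1 \<le> i" "i + 2 \<le> n"
  shows "tA i (coef (rot 1 a)) = rotH i a" "tA i (coef (rot 2 a)) = rotH (Suc i) a"
proof -
  show "tA i (coef (rot 2 a)) = rotH (Suc i) a"
    using assms by (simp add: rotH_def)
  show "tA i (coef (rot 1 a)) = rotH i a"
  proof (cases "i = 1")
    case False
    then show ?thesis
      \<comment> \<open>The edges \<open>i, i + 1\<close> and \<open>i - 1, i\<close> are compared
        at their common vertex.\<close>
      using compat[of "i + 1" i "i - 1" a] assms
      unfolding vmap_def emb_first_two emb_last_two by (simp add: rotH_def)
  qed (simp add: rotH_def)
qed

lemma tB_left:
  assumes "1 \<le> i" "i + 1 < j" "j < n"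
  shows "tB i j (coef (rot 1 a), coef (rot 1 0)) = rotH i a"
proof (cases "i = 1")
  case True
  then show ?thesis
    \<comment> \<open>Vertex 1 has no predecessor, so the comparison goes through vertex 2, which
      differs from \<open>j\<close>.\<close>
    using compat[of j i 2 a] assms
    unfolding vmap_def emb_first_two emb_last_two cl_one_rot by (simp add: rotH_def)
next
  case False
  then show ?thesis
    using compat[of j i "i - 1" a] assms
    unfolding vmap_def emb_first_two emb_last_two cl_one_rot by (simp add: rotH_def)
qed

lemma tB_right:
  assumes "1 \<le> i" "i + 1 < j" "j < n"
  shows "tB i j (coef (rot 1 0), coef (rot 1 b)) = rotH j b"
  using compat[of i j "j - 1" b] assms
  unfolding vmap_def emb_first_two emb_last_two cl_one_rot by (simp add: rotH_def)

text \<open>A pair in Spin(2) x Spin(2) factors through the two coordinate subgroups in both orders.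
  Together the two equations make far-apart vertices commute in \<open>H\<close>.\<close>

lemma tB_rot:
  assumes "1 \<le> i" "i + 1 < j" "j < n"
  shows "tB i j (coef (rot 1 a), coef (rot 1 b)) = rotH i a \<otimes> rotH j b"
    and "tB i j (coef (rot 1 a), coef (rot 1 b)) = rotH j b \<otimes> rotH i a"
proof -
  have c: "(coef (rot 1 a), coef (rot 1 0)) \<in> carrier spin22" "(coef (rot 1 0), coef (rot 1 b)) \<in> carrier spin22"
    unfolding spin22_carrier by blast+
  show "tB i j (coef (rot 1 a), coef (rot 1 b)) = rotH i a \<otimes> rotH j b"
    using hom_mult[OF homB[OF assms] c] unfolding spin22_mult tB_left[OF assms] tB_right[OF assms]
    by (simp only: add_0_left add_0_right)
  show "tB i j (coef (rot 1 a), coef (rot 1 b)) = rotH j b \<otimes> rotH i a"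
    using hom_mult[OF homB[OF assms] c(2,1)] unfolding spin22_mult tB_left[OF assms] tB_right[OF assms]
    by (simp only: add_0_left add_0_right)
qed

text \<open>The same \<open>k\<close> and \<open>j\<close> serve all angles, so closure and
  additivity of \<open>rotH i\<close> are inherited from one homomorphism on Spin(3).\<close>

lemma rotH_cases:
  assumes "1 \<le> i" "i < n"
  shows "\<exists>k j. 1 \<le> k \<and> k + 2 \<le> n \<and> 1 \<le> j \<and> j < 3 \<and> (\<forall>a. rotH i a = tA k (coef (rot j a)))"
proof (cases "i = 1")
  case True
  then show ?thesis
    using n3 by (intro exI[of _ 1]) (simp add: rotH_def)
next
  case False
  then show ?thesis
    using assms by (intro exI[of _ "i - 1"] exI[of _ 2]) (auto simp: rotH_def)
qed

lemma rotH_closed: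
  assumes "1 \<le> i" "i < n"
  shows "rotH i a \<in> carrier H"
proof -
  obtain k j where *: "1 \<le> k" "k + 2 \<le> n" "1 \<le> j" "j < 3" "\<And>a. rotH i a = tA k (coef (rot j a))"
    using rotH_cases[OF assms] by blast
  show ?thesis
    unfolding *(5) by (rule hom_coef_closed[OF homA[OF *(1,2)] _ rot_rotors[OF *(3,4)]]) simp
qed

lemma rotH_add:
  assumes "1 \<le> i" "i < n"
  shows "rotH i (a + b) = rotH i a \<otimes> rotH i b"
proof -
  obtain k j where *: "1 \<le> k" "k + 2 \<le> n" "1 \<le> j" "j < 3" "\<And>a. rotH i a = tA k (coef (rot j a))"
    using rotH_cases[OF assms] by blast
  show ?thesis
    using hom_coef_mult[OF homA[OF *(1,2)] _ rot_rotors[OF *(3,4), of a] rot_rotors[OF *(3,4), of b]]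
    unfolding *(5) rot_mult[OF *(3)] by simp
qed

section \<open>The braided chain of subgroups in Spin(n) x H\<close>

definition rot_pair :: "nat \<Rightarrow> real \<Rightarrow> mvec \<times> 'a" where
  "rot_pair i a = (coef (rot i a), rotH i a)"

abbreviation pairs :: "(mvec \<times> 'a) monoid" where
  "pairs \<equiv> spin_grp n \<times>\<times> H"

lemma pairs_mult: "monoid.mult pairs (x, g) (y, h) = (cl_mult n x y, g \<otimes> h)"
  by (simp add: DirProd_def mult_spin_grp)

lemma rot_pair_closed:
  assumes "1 \<le> i" "i < n"
  shows "rot_pair i a \<in> carrier pairs"
  using assms n3 rotH_closed rot_rotors by (auto simp: rot_pair_def DirProd_def spin_grp_rotors)

lemma rot_pair_mult:
  assumes "1 \<le> i" "i < n" "1 \<le> j" "j < n"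
  shows "monoid.mult pairs (rot_pair i a) (rot_pair j b) = (coef (rot i a * rot j b), rotH i a \<otimes> rotH j b)"
  using assms by (simp add: rot_pair_def mult_spin_grp coef_rotors_mult rot_rotors)

lemma rot_pair_mult3:
  assumes "1 \<le> i" "i < n" "1 \<le> j" "j < n" "1 \<le> k" "k < n"
  shows "monoid.mult pairs (monoid.mult pairs (rot_pair i a) (rot_pair j b)) (rot_pair k c)
    = (coef (rot i a * rot j b * rot k c), rotH i a \<otimes> rotH j b \<otimes> rotH k c)"
  unfolding rot_pair_mult[OF assms(1-4)] rot_pair_def[of k] pairs_mult
  using assms by (simp add: mult_spin_grp coef_rotors_mult rot_rotors rotors_mult)

text \<open>Both components need the same new angles. These are found once in Spin(3) and carried to
  \<open>H\<close> by \<open>tA i\<close> and to Spin(n) by \<open>tauA i\<close>.\<close>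

lemma rot_pair_braid:
  assumes "1 \<le> i" "i + 2 \<le> n"
  shows "\<exists>a' b' c'. monoid.mult pairs (monoid.mult pairs (rot_pair (Suc i) a) (rot_pair i b)) (rot_pair (Suc i) c)
    = monoid.mult pairs (monoid.mult pairs (rot_pair i a') (rot_pair (Suc i) b')) (rot_pair i c')"
proof -
  have i: "i < n" "Suc i < n" "1 \<le> Suc i"
    using assms by auto
  obtain a' b' c' where eq: "rot 2 a * rot 1 b * rot 2 c = rot 1 a' * rot 2 b' * rot 1 c'"
    using rot_braid[of 1 a b c] by (auto simp: numeral_2_eq_2)
  note m = rotors_mult rotors_three_rot
  have le: "2 \<le> (3::nat)" by simp
  \<comment> \<open>The target group is left open so that the equations serve both
    homomorphisms.\<close>
  have hom: "f (coef (rot 2 a * rot 1 b * rot 2 c)) = f (coef (rot 2 a)) \<otimes>\<^bsub>K\<^esub> f (coef (rot 1 b)) \<otimes>\<^bsub>K\<^esub> f (coef (rot 2 c))"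
    "f (coef (rot 1 a' * rot 2 b' * rot 1 c')) = f (coef (rot 1 a')) \<otimes>\<^bsub>K\<^esub> f (coef (rot 2 b')) \<otimes>\<^bsub>K\<^esub> f (coef (rot 1 c'))"
    if "f \<in> hom (spin_grp 3) K" for f and K :: "('k, 'l) monoid_scheme"
    by (simp_all only: hom_coef_mult[OF that le] m)
  have "rotH (Suc i) a \<otimes> rotH i b \<otimes> rotH (Suc i) c = rotH i a' \<otimes> rotH (Suc i) b' \<otimes> rotH i c'"
    using hom[OF homA[OF assms]] unfolding tA_rot[OF assms] eq by (rule trans[OF sym])
  moreover have "coef (rot (Suc i) a * rot i b * rot (Suc i) c) = coef (rot i a' * rot (Suc i) b' * rot i c')"
    using hom[OF tauA_hom[OF assms]] i assms(1) unfolding tauA_rot[OF assms(1)] eq mult_spin_grp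
    by (simp add: coef_rotors_mult rot_rotors rotors_mult)
  ultimately show ?thesis
    unfolding rot_pair_mult3[OF i(3,2) assms(1) i(1) i(3,2)] rot_pair_mult3[OF assms(1) i(1) i(3,2) assms(1) i(1)]
    by metis
qed

lemma rot_pair_add:
  assumes "1 \<le> i" "i < n"
  shows "rot_pair i (a + b) = monoid.mult pairs (rot_pair i a) (rot_pair i b)"
  unfolding rot_pair_mult[OF assms assms] rot_mult[OF assms(1)] rotH_add[OF assms, symmetric]
  by (rule rot_pair_def)

lemma group_pairs: "group pairs"
  using n3 by (intro DirProd_group group_spin_grp is_group) simp

lemma braided_pairs: "braided_subgroups pairs (\<lambda>i. range (rot_pair i)) (n - 1)"
proof (intro braided_subgroups.intro braided_subgroups_axioms.intro group_pairs)
  fix i assume "1 \<le> i" "i \<le> n - 1"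
  then have i: "1 \<le> i" "i < n" by auto
  show "subgroup (range (rot_pair i)) pairs"
    by (rule group.additive_range_subgroup[OF group_pairs rot_pair_closed[OF i] rot_pair_add[OF i]])
next
  fix i j x y assume "1 \<le> i" "Suc i < j" "j \<le> n - 1" and x: "x \<in> range (rot_pair i)" and y: "y \<in> range (rot_pair j)"
  then have ij: "1 \<le> i" "i < n" "1 \<le> j" "j < n" "i + 1 < j" by auto
  obtain a b where ab: "x = rot_pair i a" "y = rot_pair j b"
    using x y by blast
  show "x \<otimes>\<^bsub>pairs\<^esub> y = y \<otimes>\<^bsub>pairs\<^esub> x"
    unfolding ab rot_pair_mult[OF ij(1-4)] rot_pair_mult[OF ij(3,4,1,2)]
    using rot_commute[of i j a b] tB_rot[of i j a b] ij by simp
next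
  fix i x y z assume i: "1 \<le> i" "Suc i \<le> n - 1"
    and x: "x \<in> range (rot_pair (Suc i))" "y \<in> range (rot_pair i)" "z \<in> range (rot_pair (Suc i))"
  obtain a b c where abc: "x = rot_pair (Suc i) a" "y = rot_pair i b" "z = rot_pair (Suc i) c"
    using x by blast
  show "\<exists>a\<in>range (rot_pair i). \<exists>b\<in>range (rot_pair (Suc i)). \<exists>c\<in>range (rot_pair i).
      x \<otimes>\<^bsub>pairs\<^esub> y \<otimes>\<^bsub>pairs\<^esub> z = a \<otimes>\<^bsub>pairs\<^esub> b \<otimes>\<^bsub>pairs\<^esub> c"
    unfolding abc using rot_pair_braid[of i a b c] i by auto
qed

sublocale pairs: braided_subgroups pairs "\<lambda>i. range (rot_pair i)" "n - 1"
  by (rule braided_pairs)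

lemma rot_pair_chain:
  assumes "1 \<le> i" "i < n"
  shows "rot_pair i a \<in> pairs.chain (n - 1)"
proof -
  have "i \<le> n - 1" using assms by simp
  then show ?thesis
    using pairs.S_subset_chain_N[OF assms(1)] by blast
qed

text \<open>\<open>chain k\<close> uses the planes up to \<open>k, k + 1\<close>, hence only e_1,
  ..., e_(k+1) in the first component. The descent rests on this bound.\<close>

lemma fst_chain: "k < n \<Longrightarrow> d \<in> pairs.chain k \<Longrightarrow> fst d \<in> coef ` rotors (Suc k)"
proof (induction k arbitrary: d)
  case 0
  then show ?case
    by (auto simp: one_spin_grp rotors.one)
next
  case (Suc k)
  then obtain p a q where d: "d = p \<otimes>\<^bsub>pairs\<^esub> rot_pair (Suc k) a \<otimes>\<^bsub>pairs\<^esub> q" "p \<in> pairs.chain k" "q \<in> pairs.chain k"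
    unfolding pairs.chain_Suc by blast
  obtain u v where uv: "fst p = coef u" "u \<in> rotors (Suc k)" "fst q = coef v" "v \<in> rotors (Suc k)"
    using Suc.IH[OF _ d(2)] Suc.IH[OF _ d(3)] Suc.prems(1) by auto
  have r: "rot (Suc k) a \<in> rotors n" "u \<in> rotors n" "v \<in> rotors n"
    using uv rotors_mono[of _ "Suc k" n] Suc.prems(1) by (auto intro: rot_rotors)
  have r': "rot (Suc k) a \<in> rotors (Suc (Suc k))" "u \<in> rotors (Suc (Suc k))" "v \<in> rotors (Suc (Suc k))"
    using uv rotors_mono[of _ "Suc k" "Suc (Suc k)"] by (auto intro: rot_rotors)
  have "fst d = cl_mult n (cl_mult n (coef u) (coef (rot (Suc k) a))) (coef v)"
    unfolding d(1) using uv by (cases p, cases q) (simp add: mult_spin_grp rot_pair_def)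
  also have "\<dots> = coef (u * rot (Suc k) a * v)"
    using r by (simp add: coef_rotors_mult rotors_mult)
  finally show ?case
    using r' by (simp add: rotors_mult)
qed

text \<open>A rotor in the plane of \<open>e\<^sub>k\<^sub>+\<^sub>1, e\<^sub>k\<^sub>+\<^sub>2\<close> that does not involve \<open>e\<^sub>k\<^sub>+\<^sub>2\<close> is a sign, and
  the two embedded copies of \<open>Spin(2)\<close> in \<open>Spin(3)\<close> share their sign \<open>-1\<close>.\<close>

lemma rot_pair_descend:
  assumes "1 \<le> k" "Suc k \<le> n - 1" "fst (rot_pair (Suc k) a) \<in> fst ` pairs.chain k"
  shows "rot_pair (Suc k) a \<in> range (rot_pair k)"
proof -
  have "coef (rot (Suc k) a) \<in> coef ` rotors (Suc k)"
    using assms fst_chain[of k] unfolding rot_pair_def[of "Suc k" a] by auto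
  then have "rot (Suc k) a \<in> lower (Suc k)"
    using rotors_lower by (auto simp: coef_inject)
  then have "coef (rot (Suc k) a) {Suc k, Suc (Suc k)} = 0"
    by (rule lower_zero) auto
  then have "sin a = 0"
    using coef_rot_biv[of "Suc k" a] by simp
  then have eq: "rot i a = cos a *\<^sub>R 1" for i
    by (simp add: rot_def)
  have "rotH (Suc k) a = rotH k a"
    using tA_rot[of k a] assms(1,2) unfolding eq by simp
  then have "rot_pair (Suc k) a = rot_pair k a"
    by (simp add: rot_pair_def eq)
  then show ?thesis by simp
qed

text \<open>Two pairs over the same \<open>x\<close> differ by an element of the kernel of
  \<open>fst\<close>, which \<open>hom_inj_on_chain\<close> shows to be trivial.\<close>

lemma chain_graph:
  assumes "(x, g) \<in> pairs.chain (n - 1)" "(x, h) \<in> pairs.chain (n - 1)"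
  shows "g = h"
proof -
  let ?d = "(x, g) \<otimes>\<^bsub>pairs\<^esub> inv\<^bsub>pairs\<^esub> (x, h)"
  have sub: "subgroup (pairs.chain (n - 1)) pairs"
    by (rule pairs.chain_subgroup) simp
  have spin: "group (spin_grp n)"
    using n3 by (intro group_spin_grp) simp
  have c: "(x, g) \<in> carrier pairs" "(x, h) \<in> carrier pairs"
    using assms pairs.chain_carrier[of "n - 1"] by auto
  then have c': "x \<in> carrier (spin_grp n)" "g \<in> carrier H" "h \<in> carrier H"
    by (auto simp: DirProd_def)
  have d: "?d \<in> pairs.chain (n - 1)"
    using assms subgroup.m_closed[OF sub] subgroup.m_inv_closed[OF sub] by blast
  have d': "?d = (\<one>\<^bsub>spin_grp n\<^esub>, g \<otimes> inv h)"
    using inv_DirProd[OF spin is_group c'(1,3)] group.r_inv[OF spin c'(1)] by simp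
  have fst_hom: "fst \<in> hom pairs (spin_grp n)"
    by (auto simp: hom_def DirProd_def)
  have "?d = \<one>\<^bsub>pairs\<^esub>"
  proof (rule pairs.hom_inj_on_chain[OF spin fst_hom _ _ order_refl d])
    fix p assume "p \<in> range (rot_pair 1)" and p1: "fst p = \<one>\<^bsub>spin_grp n\<^esub>"
    then obtain a where p: "p = rot_pair 1 a" by blast
    \<comment> \<open>At vertex 1 \<open>rotH\<close> is by definition a function of the rotor, so
      equal first components force equal pairs. The pair at angle 0 is idempotent and hence the
      identity.\<close>
    have "coef (rot 1 a) = coef (rot 1 0)"
      using p1 unfolding p rot_pair_def one_spin_grp by simp
    then have "rot_pair 1 a = rot_pair 1 0"
      by (simp add: rot_pair_def rotH_def)
    moreover have "rot_pair 1 0 \<otimes>\<^bsub>pairs\<^esub> rot_pair 1 0 = rot_pair 1 0"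
      using rot_pair_add[of 1 0 0] n3 by simp
    ultimately show "p = \<one>\<^bsub>pairs\<^esub>"
      using pairs.l_cancel_one[of "rot_pair 1 0" "rot_pair 1 0"] rot_pair_closed[of 1 0] n3 p by simp
  next
    fix k p assume "1 \<le> k" "Suc k \<le> n - 1" "p \<in> range (rot_pair (Suc k))" "fst p \<in> fst ` pairs.chain k"
    then show "p \<in> range (rot_pair k)"
      using rot_pair_descend by blast
  next
    show "fst ?d = \<one>\<^bsub>spin_grp n\<^esub>"
      unfolding d' by simp
  qed
  then have "g \<otimes> inv h = \<one>"
    unfolding d' by (simp add: DirProd_def)
  then show ?thesis
    using c'(2,3) by (metis inv_closed inv_inv inv_equality)
qed

lemma chain_total: "x \<in> rotors n \<Longrightarrow> \<exists>h. (coef x, h) \<in> pairs.chain (n - 1)"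
proof (induction rule: rotors.induct)
  case one
  have "\<one>\<^bsub>pairs\<^esub> = (coef 1, \<one>)"
    by (simp add: DirProd_def one_spin_grp)
  then show ?case
    using pairs.one_chain[of "n - 1"] by auto
next
  case (step x i a)
  then obtain h where h: "(coef x, h) \<in> pairs.chain (n - 1)" by blast
  have "rot_pair i a \<in> pairs.chain (n - 1)"
    using rot_pair_chain step by blast
  then have "rot_pair i a \<otimes>\<^bsub>pairs\<^esub> (coef x, h) \<in> pairs.chain (n - 1)"
    using h subgroup.m_closed[OF pairs.chain_subgroup] by blast
  then show ?case
    using step by (auto simp: rot_pair_def[of i a] mult_spin_grp coef_rotors_mult rot_rotors)
qed

text \<open>The top chain is a subgroup of the product, total by \<open>chain_total\<close> and
  single-valued by \<open>chain_graph\<close>, hence the graph of a homomorphism. It contains every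
  \<open>rot_pair i a\<close>.\<close>

lemma exists_hom: "\<exists>\<psi>\<in>hom (spin_grp n) H. \<forall>i a. 1 \<le> i \<longrightarrow> i < n \<longrightarrow> \<psi> (coef (rot i a)) = rotH i a"
proof -
  \<comment> \<open>Outside Spin(n) the value is unspecified, which \<open>hom\<close>
    permits.\<close>
  define \<psi> where "\<psi> x = (THE h. (x, h) \<in> pairs.chain (n - 1))" for x
  have n2: "2 \<le> n" using n3 by simp
  have \<psi>_eq: "\<psi> x = h" if "(x, h) \<in> pairs.chain (n - 1)" for x h
    unfolding \<psi>_def using that chain_graph by blast
  have \<psi>: "(x, \<psi> x) \<in> pairs.chain (n - 1)" if "x \<in> carrier (spin_grp n)" for x
    using that chain_total \<psi>_eq unfolding spin_grp_rotors[OF n2] by blast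
  have "\<psi> \<in> hom (spin_grp n) H"
  proof (rule homI)
    fix x assume x: "x \<in> carrier (spin_grp n)"
    show "\<psi> x \<in> carrier H"
      using \<psi>[OF x] pairs.chain_carrier[of "n - 1"] by (auto simp: DirProd_def)
    fix y assume y: "y \<in> carrier (spin_grp n)"
    have "(x, \<psi> x) \<otimes>\<^bsub>pairs\<^esub> (y, \<psi> y) \<in> pairs.chain (n - 1)"
      using \<psi>[OF x] \<psi>[OF y] subgroup.m_closed[OF pairs.chain_subgroup] by blast
    then show "\<psi> (x \<otimes>\<^bsub>spin_grp n\<^esub> y) = \<psi> x \<otimes> \<psi> y"
      using \<psi>_eq unfolding pairs_mult mult_spin_grp by blast
  qed
  moreover have "\<psi> (coef (rot i a)) = rotH i a" if "1 \<le> i" "i < n" for i a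
  proof (rule \<psi>_eq)
    show "(coef (rot i a), rotH i a) \<in> pairs.chain (n - 1)"
      using rot_pair_chain[OF that, of a] unfolding rot_pair_def[of i a] .
  qed
  ultimately show ?thesis by blast
qed

section \<open>Compatibility, surjectivity and uniqueness of the homomorphism\<close>

lemma hom_tauA:
  assumes "\<psi> \<in> hom (spin_grp n) H" "\<And>i a. 1 \<le> i \<Longrightarrow> i < n \<Longrightarrow> \<psi> (coef (rot i a)) = rotH i a"
    and i: "1 \<le> i" "i + 2 \<le> n" and "x \<in> Spin 3"
  shows "\<psi> (tauA i x) = tA i x"
proof -
  have "(\<psi> \<circ> tauA i) x = tA i x"
  proof (rule hom_spin_eq[OF is_group _ _ homA[OF i] _ assms(5)])
    show "\<psi> \<circ> tauA i \<in> hom (spin_grp 3) H"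
      using Group.hom_compose[OF tauA_hom[OF i] assms(1)] .
    fix j a assume "1 \<le> j" "j < (3::nat)"
    then show "(\<psi> \<circ> tauA i) (coef (rot j a)) = tA i (coef (rot j a))"
      using tauA_rot[OF i(1), of a] tA_rot[OF i, of a] assms(2)[of i a] assms(2)[of "Suc i" a] i
      by (cases rule: rotors_three_cases) simp_all
  qed simp
  then show ?thesis by simp
qed

lemma hom_tauB:
  assumes "\<psi> \<in> hom (spin_grp n) H" "\<And>i a. 1 \<le> i \<Longrightarrow> i < n \<Longrightarrow> \<psi> (coef (rot i a)) = rotH i a"
    and ij: "1 \<le> i" "i + 1 < j" "j < n" and "p \<in> carrier spin22"
  shows "\<psi> (tauB n i j p) = tB i j p"
proof -
  have n2: "2 \<le> n" using n3 by simp
  obtain a b where p: "p = (coef (rot 1 a), coef (rot 1 b))"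
    using assms(6) unfolding spin22_carrier by blast
  have r: "i < n" "1 \<le> j" using ij by auto
  show ?thesis
    unfolding p tB_rot(1)[OF ij] tauB_rot[OF ij(1) r(1) r(2) ij(3)]
      hom_coef_mult[OF assms(1) n2 rot_rotors[OF ij(1) r(1)] rot_rotors[OF r(2) ij(3)]]
    using assms(2) ij r by simp
qed

text \<open>The image is a subgroup of \<open>H\<close> that contains the generating set of
  \<open>H\<close>.\<close>

lemma hom_surj:
  assumes "\<psi> \<in> hom (spin_grp n) H" "\<And>i a. 1 \<le> i \<Longrightarrow> i < n \<Longrightarrow> \<psi> (coef (rot i a)) = rotH i a"
  shows "\<psi> ` Spin n = carrier H"
proof
  have n2: "2 \<le> n" using n3 by simp
  interpret \<psi>: group_hom "spin_grp n" H \<psi>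
    using group_spin_grp[OF n2] assms(1) by (intro group_hom.intro group_hom_axioms.intro is_group)
  have car: "carrier (spin_grp m) = Spin m" for m by (simp add: spin_grp_def)
  show "\<psi> ` Spin n \<subseteq> carrier H"
    using \<psi>.hom_closed unfolding car by blast
  have A: "tA i x \<in> \<psi> ` Spin n" if "1 \<le> i" "i + 1 \<le> n - 1" "x \<in> Spin 3" for i x
  proof -
    have i: "i + 2 \<le> n" using that by simp
    have "tauA i x \<in> Spin n"
      using hom_in_carrier[OF tauA_hom[OF that(1) i]] that(3) unfolding car .
    then show ?thesis
      using hom_tauA[OF assms that(1) i that(3)] by force
  qed
  have B: "tB i j p \<in> \<psi> ` Spin n" if "1 \<le> i" "i + 1 < j" "j \<le> n - 1" "p \<in> carrier spin22" for i j p
  proof -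
    have j: "j < n" using that by simp
    have "tauB n i j p \<in> Spin n"
      using hom_in_carrier[OF tauB_hom[OF that(1,2) j] that(4)] unfolding car .
    then show ?thesis
      using hom_tauB[OF assms that(1,2) j that(4)] by force
  qed
  have "carrier H = generate H
        ((\<Union>i\<in>{i. 1 \<le> i \<and> i + 1 \<le> n - 1}. tA i ` Spin 3) \<union>
         (\<Union>(i, j)\<in>{(i, j). 1 \<le> i \<and> i + 1 < j \<and> j \<le> n - 1}. tB i j ` carrier spin22))"
    using env unfolding envelope_def by blast
  also have "\<dots> \<subseteq> \<psi> ` Spin n"
  proof (rule generate_subgroup_incl)
    show "subgroup (\<psi> ` Spin n) H"
      using \<psi>.img_is_subgroup unfolding car .
  qed (use A B in blast)
  finally show "carrier H \<subseteq> \<psi> ` Spin n" .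
qed

text \<open>The images of the maps \<open>tauA i\<close> contain all elementary rotors, and these
  generate Spin(n).\<close>

lemma hom_determined:
  assumes "\<psi> \<in> hom (spin_grp n) H" "\<And>i x. 1 \<le> i \<Longrightarrow> i + 1 \<le> n - 1 \<Longrightarrow> x \<in> Spin 3 \<Longrightarrow> \<psi> (tauA i x) = tA i x"
    and \<psi>': "\<psi>' \<in> hom (spin_grp n) H" "\<And>i x. 1 \<le> i \<Longrightarrow> i + 1 \<le> n - 1 \<Longrightarrow> x \<in> Spin 3 \<Longrightarrow> \<psi>' (tauA i x) = tA i x"
    and "x \<in> Spin n"
  shows "\<psi>' x = \<psi> x"
proof (rule hom_spin_eq[OF is_group _ \<psi>'(1) assms(1) _ assms(5)])
  fix i a assume "1 \<le> i" "i < n"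
  then show "\<psi>' (coef (rot i a)) = \<psi> (coef (rot i a))"
    using rot_generators[of i n a] n3 assms(2) \<psi>'(2) by metis
qed (use n3 in simp)

end

text \<open>Uniqueness of \<open>\<psi>\<close> means agreement on \<open>Spin n\<close>, since
  \<open>hom\<close> does not constrain values off the carrier. The type \<open>'g\<close> is a
  parameter, so \<open>H\<close> may live on any type.\<close>

theorem mainTheorem6:
  fixes n :: nat
    and H :: "('g, 'z) monoid_scheme"
    and sA :: "nat \<Rightarrow> mvec \<Rightarrow> 'g"
    and sB :: "nat \<Rightarrow> nat \<Rightarrow> mvec \<times> mvec \<Rightarrow> 'g"
  assumes "n \<ge> 3"
  shows "envelope n (spin_grp n) tauA (tauB n) \<and>
    (envelope n H sA sB \<longrightarrow>
      (\<exists>\<psi>. \<psi> \<in> hom (spin_grp n) H \<and> \<psi> ` Spin n = carrier H \<and>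
         (\<forall>i. 1 \<le> i \<and> i + 1 \<le> n - 1 \<longrightarrow> (\<forall>x\<in>Spin 3. \<psi> (tauA i x) = sA i x)) \<and>
         (\<forall>i j. 1 \<le> i \<and> i + 1 < j \<and> j \<le> n - 1 \<longrightarrow>
            (\<forall>p\<in>carrier spin22. \<psi> (tauB n i j p) = sB i j p)) \<and>
         (\<forall>\<psi>'. \<psi>' \<in> hom (spin_grp n) H \<and>
            (\<forall>i. 1 \<le> i \<and> i + 1 \<le> n - 1 \<longrightarrow> (\<forall>x\<in>Spin 3. \<psi>' (tauA i x) = sA i x)) \<and>
            (\<forall>i j. 1 \<le> i \<and> i + 1 < j \<and> j \<le> n - 1 \<longrightarrow>
               (\<forall>p\<in>carrier spin22. \<psi>' (tauB n i j p) = sB i j p))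
            \<longrightarrow> (\<forall>x\<in>Spin n. \<psi>' x = \<psi> x))))"
proof (intro conjI impI)
  show "envelope n (spin_grp n) tauA (tauB n)"
    by (rule envelope_spin[OF assms])
next
  assume env: "envelope n H sA sB"
  then have "group H"
    unfolding envelope_def by blast
  then interpret spin_envelope H n sA sB
    using env assms by (intro spin_envelope.intro spin_envelope_axioms.intro)
  obtain \<psi> where hom: "\<psi> \<in> hom (spin_grp n) H"
    and rot: "\<And>i a. 1 \<le> i \<Longrightarrow> i < n \<Longrightarrow> \<psi> (coef (rot i a)) = rotH i a"
    using exists_hom by blast
  have A: "\<psi> (tauA i x) = sA i x" if "1 \<le> i" "i + 1 \<le> n - 1" "x \<in> Spin 3" for i x
    using that by (intro hom_tauA[OF hom rot]) auto
  have B: "\<psi> (tauB n i j p) = sB i j p" if "1 \<le> i" "i + 1 < j" "j \<le> n - 1" "p \<in> carrier spin22" for i j p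
    using that by (intro hom_tauB[OF hom rot]) auto
  show "\<exists>\<psi>. \<psi> \<in> hom (spin_grp n) H \<and> \<psi> ` Spin n = carrier H \<and>
         (\<forall>i. 1 \<le> i \<and> i + 1 \<le> n - 1 \<longrightarrow> (\<forall>x\<in>Spin 3. \<psi> (tauA i x) = sA i x)) \<and>
         (\<forall>i j. 1 \<le> i \<and> i + 1 < j \<and> j \<le> n - 1 \<longrightarrow>
            (\<forall>p\<in>carrier spin22. \<psi> (tauB n i j p) = sB i j p)) \<and>
         (\<forall>\<psi>'. \<psi>' \<in> hom (spin_grp n) H \<and>
            (\<forall>i. 1 \<le> i \<and> i + 1 \<le> n - 1 \<longrightarrow> (\<forall>x\<in>Spin 3. \<psi>' (tauA i x) = sA i x)) \<and>
            (\<forall>i j. 1 \<le> i \<and> i + 1 < j \<and> j \<le> n - 1 \<longrightarrow>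
               (\<forall>p\<in>carrier spin22. \<psi>' (tauB n i j p) = sB i j p))
            \<longrightarrow> (\<forall>x\<in>Spin n. \<psi>' x = \<psi> x))"
  proof (intro exI[of _ \<psi>] conjI allI impI ballI)
    show "\<psi> \<in> hom (spin_grp n) H" by (rule hom)
    show "\<psi> ` Spin n = carrier H" by (rule hom_surj[OF hom rot])
  next
    fix i x assume "1 \<le> i \<and> i + 1 \<le> n - 1" "x \<in> Spin 3"
    then show "\<psi> (tauA i x) = sA i x" using A by blast
  next
    fix i j p assume "1 \<le> i \<and> i + 1 < j \<and> j \<le> n - 1" "p \<in> carrier spin22"
    then show "\<psi> (tauB n i j p) = sB i j p" using B by blast
  next
    fix \<psi>' x
    assume *: "\<psi>' \<in> hom (spin_grp n) H \<and>
        (\<forall>i. 1 \<le> i \<and> i + 1 \<le> n - 1 \<longrightarrow> (\<forall>x\<in>Spin 3. \<psi>' (tauA i x) = sA i x)) \<and>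
        (\<forall>i j. 1 \<le> i \<and> i + 1 < j \<and> j \<le> n - 1 \<longrightarrow>
           (\<forall>p\<in>carrier spin22. \<psi>' (tauB n i j p) = sB i j p))" and x: "x \<in> Spin n"
    show "\<psi>' x = \<psi> x"
      by (rule hom_determined[OF hom A _ _ x]) (use * in blast)+
  qed
qed

end
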